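(* If a Seymour orientation is the Cayley digraph of an abelian group, then it can be constructed (up to isomorphism) by taking (possibly repeated) lexicographic products of empty graphs, $k$-th powers of directed cycles, and regular tournaments.
   Context: All directed graphs are finite, with non-empty vertex set, and without loops or multiple arcs; in particular the groups are finite. An orientation is a directed graph with no directed cycle of length 2. For a directed graph $G$ and $v\in V(G)$, $N_1(G,v)=\{w : (v,w)\in E(G)\}$ and $N_2(G,v)=\{w\in V(G)\setminus(N_1(G,v)\cup\{v\}) : \exists u\in N_1(G,v),\ (u,w)\in E(G)\}$. A Seymour orientation is an orientation $G$ with $|N_1(G,v)|\ge|N_2(G,v)|$ for all $v\in V(G)$. The Cayley digraph $\Gamma(A,S)$ of an abelian group $A$ with connection set $S\subseteq A\setminus\{0\}$ has vertex set $A$ and an arc from $g$ to $g+s$ for all $g\in A$, $s\in S$; it is an orientation exactly when $S\cap(-S)=\emptyset$. The lexicographic product $D[G]$ of directed graphs $D,G$ has vertex set $V(D)\times V(G)$, with an arc from $(v,i)$ to $(w,j)$ iff $(v,w)\in E(D)$, or $v=w$ and $(i,j)\in E(G)$. An empty graph is a digraph on $m\ge 1$ vertices without arcs. The directed cycle $\overrightarrow{C_n}$ ($n\ge3$) has vertex set $\mathbb{Z}_n$ and arcs $(i,i+1)$; its $k$-th power ($k\ge1$, $2k<n$) has an arc from $v$ to $w\neq v$ iff there is a directed path of length at most $k$ from $v$ to $w$, i.e. arcs $(i,i+1),\dots,(i,i+k)$ for each $i$. A regular tournament is a tournament in which all vertices have the same out-degree. "Constructed by (possibly repeated) lexicographic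 products" of these building blocks means belonging to the smallest isomorphism-closed class containing the building blocks and closed under $(D,G)\mapsto D[G]$. *)

theory Defs
  imports
    "Graph_Theory.Graph_Theory"
    "HOL-Algebra.Group"
begin

text \<open>
  Digraphs are finite, loopless and without multiple arcs, hence represented by the
  pair digraphs of \<^theory>\<open>Graph_Theory.Pair_Digraph\<close>. The locale \<^locale>\<open>pair_digraph\<close> allows
  the null graph, so non-emptiness is added explicitly.
\<close>

definition nonempty_digraph :: "'a pair_pre_digraph \<Rightarrow> bool" where
  "nonempty_digraph G \<longleftrightarrow> pair_digraph G \<and> pverts G \<noteq> {}"

definition orientation :: "'a pair_pre_digraph \<Rightarrow> bool" where
  "orientation G \<longleftrightarrow> nonempty_digraph G \<and> (\<forall>u v. (u, v) \<in> parcs G \<longrightarrow> (v, u) \<notin> parcs G)"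

definition N1 :: "'a pair_pre_digraph \<Rightarrow> 'a \<Rightarrow> 'a set" where
  "N1 G v = {w. (v, w) \<in> parcs G}"

definition N2 :: "'a pair_pre_digraph \<Rightarrow> 'a \<Rightarrow> 'a set" where
  "N2 G v = {w \<in> pverts G - (N1 G v \<union> {v}). \<exists>u \<in> N1 G v. (u, w) \<in> parcs G}"

definition seymour_orientation :: "'a pair_pre_digraph \<Rightarrow> bool" where
  "seymour_orientation G \<longleftrightarrow>
     orientation G \<and> (\<forall>v \<in> pverts G. card (N1 G v) \<ge> card (N2 G v))"

text \<open>The group is written multiplicatively, as in HOL-Algebra.\<close>

definition cayley_digraph :: "('a, 'b) monoid_scheme \<Rightarrow> 'a set \<Rightarrow> 'a pair_pre_digraph" where
  "cayley_digraph A S =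
     \<lparr>pverts = carrier A, parcs = {(g, g \<otimes>\<^bsub>A\<^esub> s) | g s. g \<in> carrier A \<and> s \<in> S}\<rparr>"

definition lex_product ::
    "'a pair_pre_digraph \<Rightarrow> 'b pair_pre_digraph \<Rightarrow> ('a \<times> 'b) pair_pre_digraph" where
  "lex_product D G =
     \<lparr>pverts = pverts D \<times> pverts G,
      parcs = {((v, i), (w, j)) | v i w j.
        v \<in> pverts D \<and> w \<in> pverts D \<and> i \<in> pverts G \<and> j \<in> pverts G \<and>
        ((v, w) \<in> parcs D \<or> v = w \<and> (i, j) \<in> parcs G)}\<rparr>"

definition empty_graph :: "'a pair_pre_digraph \<Rightarrow> bool" where
  "empty_graph G \<longleftrightarrow> nonempty_digraph G \<and> parcs G = {}"

definition directed_cycle :: "nat \<Rightarrow> nat pair_pre_digraph" where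
  "directed_cycle n = \<lparr>pverts = {..<n}, parcs = {(i, (i + 1) mod n) | i. i < n}\<rparr>"

definition digraph_power :: "'a pair_pre_digraph \<Rightarrow> nat \<Rightarrow> 'a pair_pre_digraph" where
  "digraph_power G k =
     \<lparr>pverts = pverts G,
      parcs = {(v, w). v \<noteq> w \<and>
        (\<exists>p. pre_digraph.apath (with_proj G) v p w \<and> length p \<le> k)}\<rparr>"

definition tournament :: "'a pair_pre_digraph \<Rightarrow> bool" where
  "tournament G \<longleftrightarrow> orientation G \<and>
     (\<forall>u \<in> pverts G. \<forall>v \<in> pverts G. u \<noteq> v \<longrightarrow> (u, v) \<in> parcs G \<or> (v, u) \<in> parcs G)"

definition regular_tournament :: "'a pair_pre_digraph \<Rightarrow> bool" where
  "regular_tournament G \<longleftrightarrow> tournament G \<and>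
     (\<exists>d. \<forall>v \<in> pverts G. out_degree (with_proj G) v = d)"

text \<open>
  The smallest isomorphism-closed class containing the building blocks and closed under
  lexicographic products. An inductive predicate lives on a single vertex type, and the
  product changes the type; since every finite digraph has an isomorphic copy on natural
  numbers, the class is generated on \<^typ>\<open>nat\<close> (a product being replaced by any of its copies
  there) and then transported along isomorphism to arbitrary vertex types.
\<close>

inductive constructible_nat :: "nat pair_pre_digraph \<Rightarrow> bool" where
  empty: "empty_graph G \<Longrightarrow> constructible_nat G"
| cycle_power: "n \<ge> 3 \<Longrightarrow> k \<ge> 1 \<Longrightarrow> 2 * k < n \<Longrightarrow>
    constructible_nat (digraph_power (directed_cycle n) k)"
| regular_tournament: "regular_tournament G \<Longrightarrow> constructible_nat G"
| lex_product: "constructible_nat D \<Longrightarrow> constructible_nat G \<Longrightarrow>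
    digraph_iso (with_proj (lex_product D G)) (with_proj H) \<Longrightarrow> constructible_nat H"
| iso: "constructible_nat G \<Longrightarrow> digraph_iso (with_proj G) (with_proj H) \<Longrightarrow> constructible_nat H"

definition constructible :: "'a pair_pre_digraph \<Rightarrow> bool" where
  "constructible G \<longleftrightarrow>
     (\<exists>H. constructible_nat H \<and> digraph_iso (with_proj H) (with_proj G))"

end

theory Submission
  imports Defs "HOL-Algebra.Multiplicative_Group"
begin

text \<open>
  Write the group multiplicatively and let \<open>T = S \<union> {\<one>}\<close>. The Seymour condition at \<open>\<one>\<close> says
  \<open>|T T| \<le> 2 |T| - 1\<close>, and the orientation condition says that \<open>x y = \<one>\<close> with \<open>x, y \<in> T\<close>
  forces \<open>x = \<one>\<close>. Hamidoune's isoperimetric method (atoms) shows that in such a situation \<open>T = {\<one>}\<close>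
  (an empty graph), or \<open>T T\<close> is the whole group (a regular tournament), or \<open>T\<close> is an initial interval
  of powers of a generator (a power of a directed cycle), or there is a proper non-trivial subgroup
  \<open>H\<close> such that \<open>T - H\<close> is a union of cosets of \<open>H\<close>. In the last case the digraph is the
  lexicographic product of Cayley digraphs of \<open>G / H\<close> and \<open>H\<close>, and both inherit the hypotheses
  because \<open>|T T| \<ge> 2 |T| - 1\<close> always holds for asymmetric \<open>T\<close>.
\<close>

section \<open>Atoms and fragments in finite abelian groups\<close>

text \<open>The bound \<open>|T T| \<ge> 2 |T| - 1\<close> is the diagonal case of a theorem of
  Scherk. It has to precede the classification, because already the proof that \<open>T\<close> is
  periodic outside a subgroup \<open>H\<close> needs it for \<open>T \<inter> H\<close>. Both
  results start from a 1-atom, which is a subgroup \<open>H\<close>. The bound needs nothing more,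
  but the classification gains nothing when \<open>H = {\<one>}\<close>. In that case
  \<open>T\<close> itself has minimal boundary \<open>|T| - 1\<close>, and 2-atoms take over: a
  2-atom is either a subgroup or a pair \<open>{\<one>, d}\<close>, and a pair says that translating
  \<open>T\<close> by \<open>d\<close> adds at most one new point. This yields the interval. If
  \<open>T T\<close> misses exactly one element, \<open>T\<close> is not a 2-fragment, and a
  suitable \<open>d\<close> is read off from that element.\<close>

lemma mem_set_mult: "z \<in> X <#>\<^bsub>G\<^esub> Y \<longleftrightarrow> (\<exists>x\<in>X. \<exists>y\<in>Y. z = x \<otimes>\<^bsub>G\<^esub> y)"
  by (auto simp: set_mult_def)

lemma mem_r_coset: "z \<in> X #>\<^bsub>G\<^esub> a \<longleftrightarrow> (\<exists>x\<in>X. z = x \<otimes>\<^bsub>G\<^esub> a)"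
  by (auto simp: r_coset_def)

locale finite_comm_group = comm_group +
  assumes fin: "finite (carrier G)"
begin

lemma fin_sub: "X \<subseteq> carrier G \<Longrightarrow> finite X"
  using fin finite_subset by blast

lemma set_mult_carrier: "X \<subseteq> carrier G \<Longrightarrow> Y \<subseteq> carrier G \<Longrightarrow> X <#> Y \<subseteq> carrier G"
  by (auto simp: mem_set_mult subset_iff)

lemma r_coset_carrier_subset: "a \<in> carrier G \<Longrightarrow> X \<subseteq> carrier G \<Longrightarrow> X #> a \<subseteq> carrier G"
  by (auto simp: mem_r_coset subset_iff)

lemma card_r_coset:
  assumes "a \<in> carrier G" "X \<subseteq> carrier G"
  shows "card (X #> a) = card X"
proof -
  have "X #> a = (\<lambda>x. x \<otimes> a) ` X" by (auto simp: r_coset_def)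
  moreover have "inj_on (\<lambda>x. x \<otimes> a) X"
    using assms by (intro inj_onI) (auto simp: subset_iff)
  ultimately show ?thesis by (simp add: card_image)
qed

lemma r_coset_set_mult:
  assumes "a \<in> carrier G" "X \<subseteq> carrier G" "T \<subseteq> carrier G"
  shows "(X #> a) <#> T = (X <#> T) #> a"
proof -
  have "x \<otimes> a \<otimes> t = x \<otimes> t \<otimes> a" if "x \<in> X" "t \<in> T" for x t
    using assms that by (simp add: m_ac subset_iff)
  then show ?thesis
    by (simp add: set_mult_def r_coset_def cong: SUP_cong)
qed

lemma card_le_set_mult:
  assumes "X \<subseteq> carrier G" "T \<subseteq> carrier G" "x \<in> X"
  shows "card T \<le> card (X <#> T)"
proof -
  have "t \<otimes> x = x \<otimes> t" if "t \<in> T" for t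
    using assms that m_comm by blast
  then have "T #> x \<subseteq> X <#> T"
    using assms(3) by (auto simp: set_mult_def r_coset_def)
  then have "card (T #> x) \<le> card (X <#> T)"
    using assms by (intro card_mono fin_sub set_mult_carrier)
  with assms show ?thesis by (auto simp: card_r_coset)
qed

text \<open>Multiplication by \<open>T\<close> distributes over unions but only semi-distributes
  over intersections. As \<open>card\<close> is modular, the boundary size
  \<open>|X T| - |X|\<close> is submodular, which is what drives the isoperimetric method.\<close>

lemma card_set_mult_submodular:
  assumes "X \<subseteq> carrier G" "Y \<subseteq> carrier G" "T \<subseteq> carrier G"
  shows "card ((X \<union> Y) <#> T) + card ((X \<inter> Y) <#> T) \<le> card (X <#> T) + card (Y <#> T)"
proof -
  have f: "finite (X <#> T)" "finite (Y <#> T)"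
    using assms fin_sub set_mult_carrier by auto
  have "(X \<union> Y) <#> T = (X <#> T) \<union> (Y <#> T)"
    by (auto simp: set_mult_def)
  moreover have "(X \<inter> Y) <#> T \<subseteq> (X <#> T) \<inter> (Y <#> T)"
    by (intro Int_greatest mono_set_mult) auto
  then have "card ((X \<inter> Y) <#> T) \<le> card ((X <#> T) \<inter> (Y <#> T))"
    using f by (intro card_mono) auto
  ultimately show ?thesis
    using card_Un_Int[OF f] by simp
qed

text \<open>
  Fragments and atoms in the sense of Hamidoune. They are only used under \<open>isoperimetric T \<kappa>\<close> and \<open>k \<ge> 1\<close>, so that
  the inequality in the last conjunct of \<open>fragment\<close> is an equality.
\<close>

definition isoperimetric :: "'a set \<Rightarrow> nat \<Rightarrow> bool" where
  "isoperimetric T \<kappa> \<longleftrightarrow>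
     (\<forall>X\<subseteq>carrier G. X \<noteq> {} \<longrightarrow> X <#> T \<noteq> carrier G \<longrightarrow> card X + \<kappa> \<le> card (X <#> T))"

definition fragment :: "'a set \<Rightarrow> nat \<Rightarrow> nat \<Rightarrow> 'a set \<Rightarrow> bool" where
  "fragment T \<kappa> k X \<longleftrightarrow> X \<subseteq> carrier G \<and> k \<le> card X \<and> k \<le> card (carrier G - (X <#> T)) \<and>
     card (X <#> T) \<le> card X + \<kappa>"

definition atom :: "'a set \<Rightarrow> nat \<Rightarrow> nat \<Rightarrow> 'a set \<Rightarrow> bool" where
  "atom T \<kappa> k M \<longleftrightarrow> fragment T \<kappa> k M \<and> (\<forall>X. fragment T \<kappa> k X \<longrightarrow> card M \<le> card X)"

lemma isoperimetricD:
  "isoperimetric T \<kappa> \<Longrightarrow> X \<subseteq> carrier G \<Longrightarrow> X \<noteq> {} \<Longrightarrow> X <#> T \<noteq> carrier G \<Longrightarrow>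
    card X + \<kappa> \<le> card (X <#> T)"
  by (auto simp: isoperimetric_def)

lemma atom_exists: "fragment T \<kappa> k X \<Longrightarrow> \<exists>M. atom T \<kappa> k M"
  using ex_has_least_nat[of "fragment T \<kappa> k" X card] unfolding atom_def by blast

lemma fragment_r_coset:
  assumes "fragment T \<kappa> k X" "a \<in> carrier G" "T \<subseteq> carrier G"
  shows "fragment T \<kappa> k (X #> a)"
proof -
  have X: "X \<subseteq> carrier G" and XT: "X <#> T \<subseteq> carrier G"
    using assms set_mult_carrier by (auto simp: fragment_def)
  have "card (carrier G - ((X #> a) <#> T)) = card (carrier G - (X <#> T))"
    using assms X XT
    by (simp add: r_coset_set_mult card_Diff_subset fin_sub r_coset_carrier_subset card_r_coset)
  then show ?thesis
    using assms X XT
    by (simp add: fragment_def r_coset_set_mult r_coset_carrier_subset card_r_coset)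
qed

lemma atom_r_coset:
  assumes "atom T \<kappa> k M" "a \<in> carrier G" "T \<subseteq> carrier G"
  shows "atom T \<kappa> k (M #> a)"
  using assms fragment_r_coset[of T \<kappa> k M a] card_r_coset[of a M]
  by (auto simp: atom_def fragment_def)

lemma atom_normalized:
  assumes "fragment T \<kappa> k X" "k \<ge> 1" "T \<subseteq> carrier G"
  obtains M where "atom T \<kappa> k M" "\<one> \<in> M"
proof -
  obtain M where M: "atom T \<kappa> k M" using atom_exists assms by blast
  then have "M \<noteq> {}" and Mc: "M \<subseteq> carrier G"
    using assms(2) by (auto simp: atom_def fragment_def)
  then obtain a where a: "a \<in> M" by auto
  then have "inv a \<in> carrier G" "\<one> \<in> M #> inv a"
    using Mc by (auto simp: mem_r_coset intro!: bexI[of _ a])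
  with that atom_r_coset[OF M _ assms(3)] show ?thesis by blast
qed

text \<open>Duality: the inverse of the complement of \<open>X <#> T\<close> is again a fragment.\<close>

lemma fragment_atom_dual:
  assumes X: "fragment T \<kappa> k X" and M: "atom T \<kappa> k M" and T: "T \<subseteq> carrier G"
  shows "card (X <#> T) + card M \<le> card (carrier G)"
proof -
  let ?Y = "m_inv G ` (carrier G - (X <#> T))"
  have Xc: "X \<subseteq> carrier G" and XT: "X <#> T \<subseteq> carrier G"
    using X T set_mult_carrier by (auto simp: fragment_def)
  have inj: "inj_on (m_inv G) Z" if "Z \<subseteq> carrier G" for Z
    using that inv_inj inj_on_subset by blast
  have Yc: "?Y \<subseteq> carrier G" by auto
  have cY: "card ?Y = card (carrier G) - card (X <#> T)"
    using XT inj by (subst card_image) (auto simp: card_Diff_subset fin_sub)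
  \<comment> \<open>An equation \<open>inv y \<otimes> t = inv x\<close> would give
    \<open>y = x \<otimes> t\<close>, against \<open>y \<notin> X <#> T\<close>. So the inverses of
    \<open>X\<close> lie in the complement of \<open>?Y <#> T\<close>, which bounds both the
    boundary of \<open>?Y\<close> and its complement.\<close>
  have disj: "?Y <#> T \<subseteq> carrier G - m_inv G ` X"
  proof
    fix z assume z: "z \<in> ?Y <#> T"
    then obtain y t where y: "y \<in> carrier G" "y \<notin> X <#> T" and t: "t \<in> T" "z = inv y \<otimes> t"
      by (auto simp: mem_set_mult)
    have tc: "t \<in> carrier G" using t T by auto
    have "z \<noteq> inv x" if "x \<in> X" for x
    proof
      assume e: "z = inv x"
      have xc: "x \<in> carrier G" using that Xc by auto
      have "y = x \<otimes> t"
      proof -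
        have "inv y \<otimes> t = inv x" using e t by simp
        then have "x \<otimes> y \<otimes> (inv y \<otimes> t) = x \<otimes> y \<otimes> inv x" by simp
        moreover have "x \<otimes> y \<otimes> (inv y \<otimes> t) = x \<otimes> t"
        proof -
          have "y \<otimes> (inv y \<otimes> t) = t"
            using y tc by (simp flip: m_assoc)
          then show ?thesis using xc y tc by (simp add: m_assoc)
        qed
        moreover have "x \<otimes> y \<otimes> inv x = y"
        proof -
          have "x \<otimes> y \<otimes> inv x = y \<otimes> x \<otimes> inv x"
            using xc y by (simp add: m_comm)
          then show ?thesis using xc y by (simp add: m_assoc)
        qed
        ultimately show ?thesis by simp
      qed
      with y that t show False by (auto simp: mem_set_mult)
    qed
    then show "z \<in> carrier G - m_inv G ` X"
      using y t tc by auto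
  qed
  have iX: "card (m_inv G ` X) = card X" using Xc inj by (simp add: card_image)
  have iXc: "m_inv G ` X \<subseteq> carrier G" using Xc by auto
  have YT: "?Y <#> T \<subseteq> carrier G" using Yc T by (rule set_mult_carrier)
  have "card (?Y <#> T) \<le> card (carrier G - m_inv G ` X)"
    using disj fin by (intro card_mono) auto
  also have "\<dots> = card (carrier G) - card X"
    using iX iXc by (simp add: card_Diff_subset fin_sub)
  finally have 1: "card (?Y <#> T) \<le> card (carrier G) - card X" .
  have "m_inv G ` X \<subseteq> carrier G - (?Y <#> T)" using disj iXc by auto
  then have "card X \<le> card (carrier G - (?Y <#> T))"
    unfolding iX[symmetric] by (intro card_mono) (use fin in auto)
  moreover have "k \<le> card X" "card (X <#> T) \<le> card X + \<kappa>"
    "k \<le> card (carrier G) - card (X <#> T)"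
    using X XT by (auto simp: fragment_def card_Diff_subset fin_sub)
  moreover have le: "card (X <#> T) \<le> card (carrier G)"
    using XT fin by (rule card_mono[rotated])
  ultimately have "fragment T \<kappa> k ?Y"
    unfolding fragment_def using 1 cY Yc by auto
  then have "card M \<le> card ?Y" using M by (auto simp: atom_def)
  then show ?thesis using cY le by simp
qed

text \<open>Uncrossing: the isoperimetric inequality for \<open>M \<union> F\<close> and
  submodularity leave boundary at most \<open>\<kappa>\<close> for \<open>M \<inter> F\<close>,
  which is then a fragment, and minimality of the atom gives \<open>M \<inter> F = M\<close>.
  \<open>F\<close> is any set with boundary at most \<open>\<kappa>\<close>, so that a union of two
  atoms may be taken for it.\<close>

lemma atom_subset:
  assumes K: "isoperimetric T \<kappa>" and M: "atom T \<kappa> k M" and T: "T \<subseteq> carrier G" and k: "k \<ge> 1"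
    and F: "F \<subseteq> carrier G" "card (F <#> T) \<le> card F + \<kappa>"
    and I: "k \<le> card (M \<inter> F)" and small: "card M + card F + \<kappa> < card (carrier G) + k"
  shows "M \<subseteq> F"
proof -
  have Mc: "M \<subseteq> carrier G" and MT: "card (M <#> T) \<le> card M + \<kappa>"
    and Mk: "k \<le> card (carrier G - (M <#> T))"
    using M by (auto simp: atom_def fragment_def)
  have Ine: "M \<inter> F \<noteq> {}" and Une: "M \<union> F \<noteq> {}" using I k by auto
  have IT: "(M \<inter> F) <#> T \<subseteq> M <#> T" by (intro mono_set_mult) auto
  have cIT: "k \<le> card (carrier G - ((M \<inter> F) <#> T))"
    by (rule order_trans[OF Mk card_mono]) (use IT fin in auto)
  then have "(M \<inter> F) <#> T \<noteq> carrier G" using k by auto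
  then have 1: "card (M \<inter> F) + \<kappa> \<le> card ((M \<inter> F) <#> T)"
    using isoperimetricD[OF K _ Ine] Mc by auto
  have 2: "card ((M \<union> F) <#> T) + card ((M \<inter> F) <#> T) \<le> card (M <#> T) + card (F <#> T)"
    using card_set_mult_submodular Mc F T by auto
  \<comment> \<open>The left side is at most \<open>card M + card F + \<kappa> - k\<close>. Here
    \<open>small\<close> is what keeps the union from filling the group, so that the isoperimetric
    inequality applies to it.\<close>
  have "card ((M \<union> F) <#> T) < card (carrier G)"
    using 1 2 MT F I small by linarith
  then have "(M \<union> F) <#> T \<noteq> carrier G" by auto
  then have 3: "card (M \<union> F) + \<kappa> \<le> card ((M \<union> F) <#> T)"
    using isoperimetricD[OF K _ Une] Mc F by auto
  have 4: "card M + card F = card (M \<union> F) + card (M \<inter> F)"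
    using Mc F by (intro card_Un_Int fin_sub)
  have "card ((M \<inter> F) <#> T) \<le> card (M \<inter> F) + \<kappa>"
    using 2 3 4 MT F by linarith
  then have "fragment T \<kappa> k (M \<inter> F)"
    using I cIT Mc by (auto simp: fragment_def)
  then have "card M \<le> card (M \<inter> F)" using M by (auto simp: atom_def)
  then have "M \<inter> F = M" using Mc by (intro card_seteq fin_sub) auto
  then show ?thesis by auto
qed

text \<open>A translate of an atom is a fragment of the same size, so uncrossing makes two
  translates equal as soon as they share \<open>k\<close> points.\<close>

lemma atom_eq_r_coset:
  assumes K: "isoperimetric T \<kappa>" and M: "atom T \<kappa> k M" and T: "T \<subseteq> carrier G" and k: "k \<ge> 1"
    and a: "a \<in> carrier G" and I: "k \<le> card (M \<inter> (M #> a))"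
  shows "M #> a = M"
proof -
  have Mc: "M \<subseteq> carrier G" and fr: "fragment T \<kappa> k M"
    using M by (auto simp: atom_def fragment_def)
  \<comment> \<open>Duality applied to \<open>M\<close> itself:
    \<open>card (M <#> T) + card M\<close> is at most the order of the group, and
    \<open>card (M <#> T)\<close> is at least \<open>card M + \<kappa>\<close>.\<close>
  have "card M + \<kappa> + card M < card (carrier G) + k"
  proof (cases "card (M <#> T) < card M + \<kappa>")
    case True
    moreover have "M \<noteq> {}" "M <#> T \<noteq> carrier G" using fr k by (auto simp: fragment_def)
    ultimately show ?thesis using isoperimetricD[OF K Mc] by simp
  next
    case False
    then show ?thesis using fragment_atom_dual[OF fr M T] k by simp
  qed
  then have "M \<subseteq> M #> a"
    using a Mc fragment_r_coset[OF fr a T] I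
    by (intro atom_subset[OF K M T k]) (auto simp: card_r_coset fragment_def)
  moreover have "card (M #> a) = card M" using a Mc by (simp add: card_r_coset)
  ultimately show ?thesis
    using a Mc card_subset_eq[of "M #> a" M] by (simp add: fin_sub r_coset_carrier_subset)
qed

lemma subgroup_of_r_coset_eq:
  assumes M: "M \<subseteq> carrier G" "\<one> \<in> M" and eq: "\<And>a. a \<in> M \<Longrightarrow> M #> a = M"
  shows "subgroup M G"
proof (rule subgroupI)
  show "M \<subseteq> carrier G" by fact
  show "M \<noteq> {}" using M(2) by blast
  fix a assume a: "a \<in> M"
  have "\<one> \<in> M #> a" using M(2) eq[OF a] by simp
  then obtain b where b: "b \<in> M" "\<one> = b \<otimes> a" unfolding mem_r_coset by blast
  have "inv a = b" by (rule inv_equality) (use M(1) a b in auto)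
  then show "inv a \<in> M" using b by simp
  fix b assume b: "b \<in> M"
  have "a \<otimes> b \<in> M #> b" using a unfolding mem_r_coset by blast
  then show "a \<otimes> b \<in> M" using eq[OF b] by simp
qed

text \<open>Because \<open>\<one> \<in> M\<close>, each \<open>a \<in> M\<close> lies in both
  \<open>M\<close> and \<open>M #> a\<close>, and for \<open>k = 1\<close> a single common point
  forces equality.\<close>

lemma atom_1_subgroup:
  assumes "isoperimetric T \<kappa>" "atom T \<kappa> 1 M" "T \<subseteq> carrier G" "\<one> \<in> M"
  shows "subgroup M G"
proof (rule subgroup_of_r_coset_eq)
  show Mc: "M \<subseteq> carrier G" using assms by (auto simp: atom_def fragment_def)
  fix a assume a: "a \<in> M"
  then have ac: "a \<in> carrier G" using Mc by auto
  have "a \<in> M \<inter> (M #> a)" using a ac assms(4) by (auto simp: mem_r_coset intro!: bexI[of _ \<one>])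
  then have "M \<inter> (M #> a) \<noteq> {}" by auto
  then have "1 \<le> card (M \<inter> (M #> a))"
    using Mc fin_sub by (simp add: Suc_le_eq card_gt_0_iff)
  then show "M #> a = M" using atom_eq_r_coset[OF assms(1-3) _ ac] by simp
qed fact

end

text \<open>Stated for an arbitrary group record, since it is also applied to subgroups and quotient
  groups.\<close>

definition asym_set :: "('a, 'b) monoid_scheme \<Rightarrow> 'a set \<Rightarrow> bool" where
  "asym_set G T \<longleftrightarrow> T \<subseteq> carrier G \<and> \<one>\<^bsub>G\<^esub> \<in> T \<and>
     (\<forall>x\<in>T. \<forall>y\<in>T. x \<otimes>\<^bsub>G\<^esub> y = \<one>\<^bsub>G\<^esub> \<longrightarrow> x = \<one>\<^bsub>G\<^esub>)"

context finite_comm_group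
begin

lemma subset_set_mult:
  assumes "\<one> \<in> T" "X \<subseteq> carrier G"
  shows "X \<subseteq> X <#> T"
proof
  fix x assume x: "x \<in> X"
  then have "x \<otimes> \<one> \<in> X <#> T" using assms unfolding mem_set_mult by blast
  moreover have "x \<otimes> \<one> = x" using x assms by (intro r_one) auto
  ultimately show "x \<in> X <#> T" by simp
qed

lemma set_mult_comm:
  assumes "X \<subseteq> carrier G" "Y \<subseteq> carrier G"
  shows "X <#> Y = Y <#> X"
proof -
  have "X <#> Y \<subseteq> Y <#> X" if "X \<subseteq> carrier G" "Y \<subseteq> carrier G" for X Y
  proof
    fix z assume "z \<in> X <#> Y"
    then obtain x y where xy: "x \<in> X" "y \<in> Y" "z = x \<otimes> y" unfolding mem_set_mult by blast
    then have "z = y \<otimes> x" using that m_comm[of x y] by auto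
    with xy show "z \<in> Y <#> X" unfolding mem_set_mult by blast
  qed
  with assms show ?thesis by blast
qed

text \<open>
  If every non-trivial translate met \<open>M\<close> in at most one point, then for distinct \<open>a, b \<in> M - {\<one>}\<close>
  the set \<open>M \<union> (M #> a)\<close>, whose boundary is as small as that of an atom, would meet \<open>M #> b\<close> in the two
  points \<open>b\<close> and \<open>a \<otimes> b\<close>. It would therefore contain \<open>M #> b\<close>, which forces \<open>card M \<le> 2\<close>.
\<close>

lemma atom_2_subgroup:
  assumes K: "isoperimetric T \<kappa>" and M: "atom T \<kappa> 2 M" and T: "fragment T \<kappa> 2 T"
    and cT: "card T = \<kappa> + 1" and one: "\<one> \<in> M" and three: "3 \<le> card M"
  shows "subgroup M G"
proof -
  have Mc: "M \<subseteq> carrier G" and MT: "card (M <#> T) \<le> card M + \<kappa>" and fM: "fragment T \<kappa> 2 M"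
    and Tc: "T \<subseteq> carrier G" and MleT: "card M \<le> card T"
    using M T by (auto simp: atom_def fragment_def)
  have finM: "finite M" using Mc by (rule fin_sub)
  show ?thesis
  proof (cases "\<exists>a\<in>carrier G. a \<noteq> \<one> \<and> 2 \<le> card (M \<inter> (M #> a))")
    case True
    then obtain a where a: "a \<in> carrier G" "a \<noteq> \<one>" "2 \<le> card (M \<inter> (M #> a))" by blast
    then have aM: "M #> a = M" using atom_eq_r_coset[OF K M Tc] by simp
    \<comment> \<open>Invariance of \<open>M\<close> under one \<open>a \<noteq> \<one>\<close> puts
      \<open>a\<close> into \<open>M\<close>, since \<open>\<one> \<in> M\<close>. Then
      \<open>b\<close> and \<open>b \<otimes> a\<close> are two common points of \<open>M\<close>
      and \<open>M #> b\<close> for every \<open>b \<in> M\<close>.\<close>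
    have "M #> b = M" if b: "b \<in> M" for b
    proof -
      have bc: "b \<in> carrier G" using b Mc by auto
      have "b \<otimes> a \<in> M #> a" using b unfolding mem_r_coset by blast
      then have "b \<otimes> a \<in> M" using aM by simp
      moreover have "\<one> \<otimes> a \<in> M #> a" using one unfolding mem_r_coset by blast
      then have "a \<in> M" using a(1) aM by simp
      then have "b \<otimes> a \<in> M #> b" unfolding mem_r_coset using m_comm[OF bc a(1)] by blast
      moreover have "b \<in> M #> b" unfolding mem_r_coset using one bc by force
      ultimately have "{b, b \<otimes> a} \<subseteq> M \<inter> (M #> b)" using b by auto
      then have "card {b, b \<otimes> a} \<le> card (M \<inter> (M #> b))"
        using finM by (intro card_mono) auto
      moreover have "b \<otimes> a \<noteq> b" using a bc by simp
      ultimately have "2 \<le> card (M \<inter> (M #> b))" by simp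
      then show ?thesis using atom_eq_r_coset[OF K M Tc _ bc] by simp
    qed
    then show ?thesis by (intro subgroup_of_r_coset_eq Mc one)
  next
    case False
    \<comment> \<open>In this case \<open>M\<close> behaves like a Sidon set. Translating by
      \<open>inv x\<close> reduces two distinct translates to \<open>M\<close> and one non-trivial
      translate.\<close>
    have sidon: "card ((M #> x) \<inter> (M #> y)) \<le> 1"
      if "x \<in> carrier G" "y \<in> carrier G" "x \<noteq> y" for x y
    proof -
      let ?a = "y \<otimes> inv x"
      have a: "?a \<in> carrier G" "?a \<noteq> \<one>"
        using that inv_equality[of y "inv x"] by auto
      have "(M #> x) \<inter> (M #> y) \<subseteq> (M \<inter> (M #> ?a)) #> x"
      proof
        fix z assume "z \<in> (M #> x) \<inter> (M #> y)"
        then obtain m m' where m: "m \<in> M" "z = m \<otimes> x" "m' \<in> M" "z = m' \<otimes> y"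
          unfolding Int_iff mem_r_coset by blast
        then have mc: "m \<in> carrier G" "m' \<in> carrier G" using Mc by auto
        have "m = m' \<otimes> y \<otimes> inv x"
          using m mc that inv_solve_right[of m "m' \<otimes> y" x] by simp
        then have "m = m' \<otimes> ?a" using mc that by (simp add: m_assoc)
        then show "z \<in> (M \<inter> (M #> ?a)) #> x"
        proof -
          have "m \<in> M #> ?a" unfolding mem_r_coset using \<open>m = m' \<otimes> ?a\<close> m(3) by (rule bexI)
          then have "m \<in> M \<inter> (M #> ?a)" using m(1) by simp
          with m(2) show ?thesis unfolding mem_r_coset by (rule bexI)
        qed
      qed
      moreover have "(M \<inter> (M #> ?a)) #> x \<subseteq> carrier G"
        using Mc that(1) by (intro r_coset_carrier_subset) auto
      ultimately have "card ((M #> x) \<inter> (M #> y)) \<le> card ((M \<inter> (M #> ?a)) #> x)"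
        by (intro card_mono fin_sub)
      also have "\<dots> = card (M \<inter> (M #> ?a))"
        using Mc that(1) by (intro card_r_coset) auto
      also have "\<dots> \<le> 1" using False a by force
      finally show ?thesis .
    qed
    \<comment> \<open>Inclusion-exclusion: each of the three pairwise intersections costs at most
      one point.\<close>
    have union3: "3 * card M \<le> card ((M #> x) \<union> (M #> y) \<union> (M #> z)) + 3"
      if "x \<in> carrier G" "y \<in> carrier G" "z \<in> carrier G" "x \<noteq> y" "y \<noteq> z" "x \<noteq> z" for x y z
    proof -
      let ?X = "M #> x" and ?Y = "M #> y" and ?Z = "M #> z"
      have f: "finite ?X" "finite ?Y" "finite ?Z"
        using that Mc by (simp_all add: fin_sub r_coset_carrier_subset)
      have c: "card ?X = card M" "card ?Y = card M" "card ?Z = card M"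
        using that Mc by (auto simp: card_r_coset)
      have "card ((?X \<union> ?Y) \<inter> ?Z) \<le> card (?X \<inter> ?Z) + card (?Y \<inter> ?Z)"
        unfolding Int_Un_distrib2 by (rule card_Un_le)
      then have "card ((?X \<union> ?Y) \<inter> ?Z) \<le> 2"
        using sidon[of x z] sidon[of y z] that by simp
      then show ?thesis
        using card_Un_Int[OF f(1,2)] card_Un_Int[of "?X \<union> ?Y" ?Z] f c sidon[of x y] that by simp
    qed
    \<comment> \<open>\<open>T\<close> is a 2-fragment, hence at least as large as the atom
      \<open>M\<close>, so it has three elements. The three translates of \<open>M\<close> by them
      lie in \<open>M <#> T\<close>, whence \<open>2 * card M \<le> \<kappa> + 3\<close>.\<close>
    obtain U where "U \<subseteq> T" "card U = 3"
      using obtain_subset_with_card_n[of 3 T] three MleT by auto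
    then obtain t1 t2 t3 where t: "t1 \<in> T" "t2 \<in> T" "t3 \<in> T" "t1 \<noteq> t2" "t2 \<noteq> t3" "t1 \<noteq> t3"
      by (auto simp: card_3_iff)
    have "(M #> t1) \<union> (M #> t2) \<union> (M #> t3) \<subseteq> M <#> T"
      using t by (auto simp: set_mult_def r_coset_def)
    then have "card ((M #> t1) \<union> (M #> t2) \<union> (M #> t3)) \<le> card (M <#> T)"
      using Mc Tc by (intro card_mono fin_sub set_mult_carrier)
    then have large: "2 * card M \<le> \<kappa> + 3"
      using union3[of t1 t2 t3] t Tc MT by (simp add: subset_iff)
    obtain V where "V \<subseteq> M" "card V = 3"
      using obtain_subset_with_card_n[of 3 M] three by auto
    then obtain v1 v2 v3 where v: "v1 \<in> M" "v2 \<in> M" "v3 \<in> M" "v1 \<noteq> v2" "v2 \<noteq> v3" "v1 \<noteq> v3"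
      by (auto simp: card_3_iff)
    then obtain a b where ab: "a \<in> M" "b \<in> M" "a \<noteq> \<one>" "b \<noteq> \<one>" "a \<noteq> b" by metis
    have ac: "a \<in> carrier G" "b \<in> carrier G" using ab Mc by auto
    let ?F = "M \<union> (M #> a)"
    have Mac: "M #> a \<subseteq> carrier G" using ac Mc by (intro r_coset_carrier_subset)
    then have Fc: "?F \<subseteq> carrier G" using Mc by auto
    have M1: "M #> \<one> = M" using Mc by simp
    have aI: "a \<in> M \<inter> (M #> a)"
      using ab(1) one ac by (auto simp: mem_r_coset intro!: bexI[of _ \<one>])
    have cI: "card (M \<inter> (M #> a)) = 1"
    proof -
      have "card (M \<inter> (M #> a)) \<le> 1" using sidon[of \<one> a] ac ab M1 by simp
      moreover have "card (M \<inter> (M #> a)) \<noteq> 0" using aI finM by auto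
      ultimately show ?thesis by simp
    qed
    have cF: "card ?F + 1 = 2 * card M"
      using card_Un_Int[of M "M #> a"] cI card_r_coset[of a M] ac Mc Mac fin_sub by simp
    \<comment> \<open>The non-empty intersection contributes at least
      \<open>card T = \<kappa> + 1\<close> to the submodular inequality. As
      \<open>card ?F = 2 * card M - 1\<close>, the boundary of \<open>?F\<close> stays at most
      \<open>\<kappa>\<close>.\<close>
    have "card T \<le> card ((M \<inter> (M #> a)) <#> T)"
      using Mc Tc aI by (intro card_le_set_mult) auto
    moreover have "card ((M #> a) <#> T) = card (M <#> T)"
      using ac Mc Tc set_mult_carrier by (simp add: r_coset_set_mult card_r_coset)
    ultimately have FT: "card (?F <#> T) \<le> card ?F + \<kappa>"
      using card_set_mult_submodular[OF Mc Mac Tc] MT cT cF by linarith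
    \<comment> \<open>Duality for the fragment \<open>T\<close> makes the order of the group at
      least \<open>2 * \<kappa> + 1 + card M\<close>. Together with \<open>large\<close> this is
      just enough for the strict inequality in \<open>small\<close>.\<close>
    have "card (T <#> T) + card M \<le> card (carrier G)"
      by (rule fragment_atom_dual[OF T M Tc])
    moreover have "card T + \<kappa> \<le> card (T <#> T)"
      using T by (intro isoperimetricD[OF K]) (auto simp: fragment_def)
    ultimately have small: "card (M #> b) + card ?F + \<kappa> < card (carrier G) + 2"
      using cF large cT card_r_coset[OF ac(2) Mc] by linarith
    have "b \<in> M #> b" using one ac by (auto simp: mem_r_coset intro!: bexI[of _ \<one>])
    moreover have "a \<otimes> b \<in> M #> b" using ab unfolding mem_r_coset by blast
    moreover have "a \<otimes> b \<in> M #> a" using ab unfolding mem_r_coset using m_comm[OF ac] by blast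
    ultimately have "{b, a \<otimes> b} \<subseteq> (M #> b) \<inter> ?F" using ab by auto
    moreover have "finite ((M #> b) \<inter> ?F)" using Fc fin_sub by blast
    ultimately have "card {b, a \<otimes> b} \<le> card ((M #> b) \<inter> ?F)" by (rule card_mono[rotated])
    moreover have "b \<noteq> a \<otimes> b" using ab ac by simp
    ultimately have "2 \<le> card ((M #> b) \<inter> ?F)" by simp
    then have "M #> b \<subseteq> ?F"
      using atom_subset[OF K atom_r_coset[OF M ac(2) Tc] Tc _ Fc FT _ small] by simp
    then have "M #> b = (M \<inter> (M #> b)) \<union> ((M #> a) \<inter> (M #> b))" by auto
    then have "card (M #> b) \<le> card (M \<inter> (M #> b)) + card ((M #> a) \<inter> (M #> b))"
      using card_Un_le[of "M \<inter> (M #> b)" "(M #> a) \<inter> (M #> b)"] by simp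
    also have "\<dots> \<le> 2"
      using sidon[of \<one> b] sidon[of a b] ac ab M1 by simp
    finally show ?thesis using three card_r_coset[OF ac(2) Mc] by simp
  qed
qed

text \<open>\<open>X\<close> and its set of inverses have the same size, lie in \<open>U\<close> and
  meet only inside \<open>Z\<close>. Below, \<open>Z\<close> is \<open>{\<one>}\<close> for
  asymmetric sets and \<open>H\<close> for sets that are asymmetric modulo \<open>H\<close>.\<close>

lemma card_asymmetric_le:
  assumes "X \<subseteq> U" "U \<subseteq> carrier G" "m_inv G ` U \<subseteq> U" "finite Z"
    and *: "\<And>x y. x \<in> X \<Longrightarrow> y \<in> X \<Longrightarrow> x \<otimes> y = \<one> \<Longrightarrow> x \<in> Z"
  shows "2 * card X \<le> card U + card Z"
proof -
  have Xc: "X \<subseteq> carrier G" and fU: "finite U" using assms fin_sub by auto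
  have fX: "finite X" using Xc by (rule fin_sub)
  have c: "card (m_inv G ` X) = card X"
    using inj_on_subset[OF inv_inj Xc] by (rule card_image)
  have "X \<inter> m_inv G ` X \<subseteq> Z"
  proof
    fix x assume x: "x \<in> X \<inter> m_inv G ` X"
    then obtain y where "y \<in> X" "x = inv y" by auto
    then show "x \<in> Z" using x * Xc by auto
  qed
  then have "card (X \<inter> m_inv G ` X) \<le> card Z" using assms by (intro card_mono)
  moreover have "X \<union> m_inv G ` X \<subseteq> U" using assms by auto
  then have "card (X \<union> m_inv G ` X) \<le> card U" using fU by (rule card_mono[rotated])
  ultimately show ?thesis
    using card_Un_Int[of X "m_inv G ` X"] c fX by simp
qed

end

section \<open>Asymmetric sets with small doubling\<close>

context finite_comm_group
begin

lemma mem_r_coset_subgroup_iff: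
  assumes H: "subgroup H G" and "x \<in> carrier G" "y \<in> H #> x"
  shows "y \<in> H \<longleftrightarrow> x \<in> H"
proof -
  obtain u where u: "u \<in> H" "y = u \<otimes> x" using assms unfolding mem_r_coset by blast
  have uc: "u \<in> carrier G" using u(1) subgroup.subset[OF H] by blast
  have "x = inv u \<otimes> y" using u uc assms(2) by (simp flip: m_assoc)
  then show ?thesis
    using u H subgroup.m_closed[OF H] subgroup.m_inv_closed[OF H] by metis
qed

lemma asym_set_card_Int:
  assumes T: "asym_set G T" and H: "subgroup H G"
  shows "2 * card (T \<inter> H) \<le> card H + 1"
proof -
  have "2 * card (T \<inter> H) \<le> card H + card {\<one>}"
    by (rule card_asymmetric_le)
      (use T H subgroup.subset[OF H] subgroup.m_inv_closed[OF H] in \<open>auto simp: asym_set_def\<close>)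
  then show ?thesis by simp
qed

text \<open>
  The hypothesis on \<open>card (H <#> T)\<close> allows at most \<open>card H - 1\<close> holes of \<open>T\<close> in \<open>H <#> T\<close>, and
  asymmetry already puts about half of them inside \<open>H\<close>. By pigeonhole, all products of two cosets
  meeting \<open>T\<close> are then full, except \<open>H\<close> itself.
\<close>

lemma small_subgroup_periodic:
  assumes T: "asym_set G T" and H: "subgroup H G" and K: "isoperimetric T \<kappa>"
    and \<kappa>: "card (H <#> T) = card H + \<kappa>" and small: "\<kappa> < card T"
    and IH: "2 * card (T \<inter> H) \<le> card ((T \<inter> H) <#> (T \<inter> H)) + 1"
  shows "2 * card T \<le> card (T <#> T) + 1"
    and "card (T <#> T) + 1 \<le> 2 * card T \<Longrightarrow> x \<in> T - H \<Longrightarrow> H #> x \<subseteq> T"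
proof -
  have Tc: "T \<subseteq> carrier G" and one: "\<one> \<in> T"
    and as: "\<And>x y. x \<in> T \<Longrightarrow> y \<in> T \<Longrightarrow> x \<otimes> y = \<one> \<Longrightarrow> x = \<one>"
    using T by (auto simp: asym_set_def)
  have Hc: "H \<subseteq> carrier G" and oneH: "\<one> \<in> H"
    and Hm: "\<And>x y. x \<in> H \<Longrightarrow> y \<in> H \<Longrightarrow> x \<otimes> y \<in> H" and Hi: "\<And>x. x \<in> H \<Longrightarrow> inv x \<in> H"
    using H by (auto simp: subgroup.subset subgroup.one_closed subgroup.m_closed subgroup.m_inv_closed)
  define N where "N = H <#> T"
  define D where "D = N - (T \<union> H)"
  have Nc: "N \<subseteq> carrier G" unfolding N_def using Hc Tc by (rule set_mult_carrier)
  have TN: "T \<subseteq> N"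
    unfolding N_def set_mult_comm[OF Hc Tc] using oneH Tc by (rule subset_set_mult)
  have HN: "H \<subseteq> N" unfolding N_def using one Hc by (rule subset_set_mult)
  have fin': "finite T" "finite H" "finite N" "finite D"
    using Tc Hc Nc fin_sub D_def by auto
  have cosN: "H #> x \<subseteq> N" if "x \<in> T" for x
    unfolding N_def using that by (auto simp: set_mult_def r_coset_def)
  have "N = D \<union> (T \<union> H)" using TN HN by (auto simp: D_def)
  moreover have "card (D \<union> (T \<union> H)) = card D + card (T \<union> H)"
    using fin' by (intro card_Un_disjoint) (auto simp: D_def)
  ultimately have cN: "card N + card (T \<inter> H) = card T + card H + card D"
    using card_Un_Int[of T H] fin' by simp
  \<comment> \<open>\<open>D\<close> consists of the holes outside \<open>H\<close>. Since
    \<open>card N = card H + \<kappa>\<close> and \<open>\<kappa> < card T\<close>, they are fewer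
    than the points of \<open>T\<close> in \<open>H\<close>.\<close>
  have cD: "card D < card (T \<inter> H)"
    using cN small \<kappa> by (simp add: N_def)
  have half: "2 * card (T \<inter> H) \<le> card H + 1" using asym_set_card_Int[OF T H] .
  have hole_in: "card ((H #> x) - T) + card (T \<inter> H) = card H" if "x \<in> H" for x
  proof -
    have "H #> x = H" using that H coset_join2 Hc by blast
    then show ?thesis using card_Diff_subset_Int[of H T] fin' card_mono[of H "T \<inter> H"]
      by (simp add: Int_commute)
  qed
  have hole_out: "card ((H #> x) - T) \<le> card D" if "x \<in> T" "x \<notin> H" for x
    using that Tc mem_r_coset_subgroup_iff[OF H, of x] cosN[OF that(1)] fin'
    by (intro card_mono) (auto simp: D_def)
  have full: "\<exists>s\<in>T \<inter> (H #> x). \<exists>t\<in>T \<inter> (H #> y). s \<otimes> t = z"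
    if x: "x \<in> T" and y: "y \<in> T" and xy: "\<not> (x \<in> H \<and> y \<in> H)" and z: "z \<in> H #> (x \<otimes> y)" for x y z
  proof -
    obtain h where h: "h \<in> H" "z = h \<otimes> (x \<otimes> y)" using z unfolding mem_r_coset by blast
    have xc: "x \<in> carrier G" "y \<in> carrier G" "h \<in> carrier G" using x y h Tc Hc by auto
    \<comment> \<open>The factorisations \<open>z = (u \<otimes> x) \<otimes> (h \<otimes> inv u
      \<otimes> y)\<close> are indexed by \<open>u \<in> H\<close>. \<open>?P\<close> and
      \<open>?Q\<close> collect the \<open>u\<close> whose first or second factor is a hole of
      \<open>T\<close>.\<close>
    let ?P = "{u \<in> H. u \<otimes> x \<notin> T}" and ?Q = "{u \<in> H. h \<otimes> inv u \<otimes> y \<notin> T}"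
    have uc: "u \<in> carrier G" if "u \<in> H" for u using that Hc by auto
    have f: "finite ((H #> x) - T)" "finite ((H #> y) - T)"
      using xc Hc by (simp_all add: fin_sub r_coset_carrier_subset)
    have 1: "card ?P \<le> card ((H #> x) - T)"
    proof (rule card_inj_on_le[OF _ _ f(1)])
      show "inj_on (\<lambda>u. u \<otimes> x) ?P" using xc uc by (auto intro!: inj_onI)
      show "(\<lambda>u. u \<otimes> x) ` ?P \<subseteq> (H #> x) - T" unfolding r_coset_def by blast
    qed
    have 2: "card ?Q \<le> card ((H #> y) - T)"
    proof (rule card_inj_on_le[OF _ _ f(2)])
      show "inj_on (\<lambda>u. h \<otimes> inv u \<otimes> y) ?Q"
      proof (rule inj_onI)
        fix u v assume "u \<in> ?Q" "v \<in> ?Q" and e: "h \<otimes> inv u \<otimes> y = h \<otimes> inv v \<otimes> y"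
        then have "u \<in> carrier G" "v \<in> carrier G" using uc by auto
        with e xc have "inv u = inv v" by simp
        then show "u = v" using \<open>u \<in> carrier G\<close> \<open>v \<in> carrier G\<close> inv_inv by metis
      qed
      show "(\<lambda>u. h \<otimes> inv u \<otimes> y) ` ?Q \<subseteq> (H #> y) - T"
        using h Hm Hi unfolding r_coset_def by blast
    qed
    \<comment> \<open>With one factor in \<open>H\<close> the holes number at most
      \<open>card H - card (T \<inter> H) + card D\<close>. With both outside there are at most
      \<open>2 * card D\<close>, where \<open>half\<close> takes over.\<close>
    have 3: "card ((H #> x) - T) + card ((H #> y) - T) < card H"
    proof (cases "x \<in> H")
      case True
      then show ?thesis using hole_in[OF True] hole_out[OF y] xy cD by simp
    next
      case False
      show ?thesis
      proof (cases "y \<in> H")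
        case True
        then show ?thesis using hole_in[OF True] hole_out[OF x False] cD by simp
      next
        case y': False
        show ?thesis using hole_out[OF x False] hole_out[OF y y'] cD half by simp
      qed
    qed
    have "card (?P \<union> ?Q) < card H" using card_Un_le[of ?P ?Q] 1 2 3 by linarith
    then have "?P \<union> ?Q \<noteq> H" by auto
    then obtain u where u: "u \<in> H" "u \<otimes> x \<in> T" "h \<otimes> inv u \<otimes> y \<in> T" by blast
    have "u \<otimes> x \<in> H #> x" using u unfolding mem_r_coset by blast
    moreover have "h \<otimes> inv u \<otimes> y \<in> H #> y" using u h Hm Hi unfolding mem_r_coset by blast
    moreover have "u \<otimes> x \<otimes> (h \<otimes> inv u \<otimes> y) = z"
    proof -
      have c: "u \<in> carrier G" using u uc by simp
      have "u \<otimes> x \<otimes> (h \<otimes> v \<otimes> y) = (u \<otimes> v) \<otimes> (h \<otimes> (x \<otimes> y))" if "v \<in> carrier G" for v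
        using c xc that by (simp add: m_ac)
      from this[of "inv u"] show ?thesis using c xc h by simp
    qed
    ultimately show ?thesis using u by blast
  qed
  \<comment> \<open>Asymmetry passes to the quotient: otherwise \<open>full\<close> would write
    \<open>\<one>\<close> as \<open>s \<otimes> t\<close> with \<open>s\<close> in
    \<open>T \<inter> (H #> x)\<close>. This forces \<open>s = \<one>\<close> and hence
    \<open>x \<in> H\<close>.\<close>
  have quot: "x \<in> H" if x: "x \<in> T" and y: "y \<in> T" and xy: "x \<otimes> y \<in> H" for x y
  proof (rule ccontr)
    assume xH: "x \<notin> H"
    have "H #> (x \<otimes> y) = H" using xy H coset_join2 Hc by blast
    then obtain s t where st: "s \<in> T \<inter> (H #> x)" "t \<in> T" "s \<otimes> t = \<one>"
      using full[OF x y, of \<one>] xH oneH by auto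
    then have "\<one> \<in> H #> x" using as by force
    then show False using mem_r_coset_subgroup_iff[OF H] x Tc oneH xH by blast
  qed
  have quot': "x \<in> H \<and> y \<in> H" if "x \<in> T" "y \<in> T" "x \<otimes> y \<in> H" for x y
  proof -
    have "x \<otimes> y = y \<otimes> x" using that Tc by (intro m_comm) auto
    then show ?thesis using quot[OF that] quot[of y x] that by simp
  qed
  define N2 where "N2 = N <#> T"
  have N2c: "N2 \<subseteq> carrier G" unfolding N2_def using Nc Tc by (rule set_mult_carrier)
  have TTc: "T <#> T \<subseteq> carrier G" using Tc Tc by (rule set_mult_carrier)
  have TT: "T <#> T = ((T <#> T) - H) \<union> ((T \<inter> H) <#> (T \<inter> H))"
  proof (intro equalityI subsetI)
    fix z assume z: "z \<in> T <#> T"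
    then obtain x y where xy: "x \<in> T" "y \<in> T" "z = x \<otimes> y" unfolding mem_set_mult by blast
    show "z \<in> ((T <#> T) - H) \<union> ((T \<inter> H) <#> (T \<inter> H))"
    proof (cases "z \<in> H")
      case True
      then have "x \<in> H \<and> y \<in> H" using quot'[of x y] xy by simp
      then show ?thesis using xy unfolding Un_iff mem_set_mult by blast
    qed (use z in auto)
  next
    fix z assume "z \<in> ((T <#> T) - H) \<union> ((T \<inter> H) <#> (T \<inter> H))"
    then show "z \<in> T <#> T" unfolding Un_iff Diff_iff mem_set_mult by blast
  qed
  have T0H: "(T \<inter> H) <#> (T \<inter> H) \<subseteq> H" using Hm by (auto simp: set_mult_def)
  have "card (T <#> T) = card (((T <#> T) - H) \<union> ((T \<inter> H) <#> (T \<inter> H)))" using TT by simp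
  also have "\<dots> = card ((T <#> T) - H) + card ((T \<inter> H) <#> (T \<inter> H))"
    using T0H TTc fin' fin_sub finite_subset[OF T0H] by (intro card_Un_disjoint) auto
  finally have cTT: "card (T <#> T) = card ((T <#> T) - H) + card ((T \<inter> H) <#> (T \<inter> H))" .
  have "N2 \<subseteq> ((T <#> T) - H) \<union> H"
  proof
    fix z assume "z \<in> N2"
    then obtain n t where "n \<in> N" "t \<in> T" "z = n \<otimes> t" unfolding N2_def mem_set_mult by blast
    moreover from this obtain h x where "h \<in> H" "x \<in> T" "n = h \<otimes> x"
      unfolding N_def mem_set_mult by blast
    ultimately have hx: "h \<in> H" "x \<in> T" "t \<in> T" "z = h \<otimes> x \<otimes> t" by simp_all
    then have c: "h \<in> carrier G" "x \<in> carrier G" "t \<in> carrier G" using Hc Tc by auto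
    show "z \<in> ((T <#> T) - H) \<union> H"
    proof (cases "x \<in> H \<and> t \<in> H")
      case True
      then show ?thesis using hx Hm by simp
    next
      case False
      have "z = h \<otimes> (x \<otimes> t)" using hx c by (simp add: m_assoc)
      then have "z \<in> H #> (x \<otimes> t)" using hx unfolding mem_r_coset by blast
      then obtain a b where "a \<in> T" "b \<in> T" "z = a \<otimes> b" using full[OF hx(2,3) False] by blast
      then have "z \<in> T <#> T" unfolding mem_set_mult by blast
      then show ?thesis by simp
    qed
  qed
  then have "card N2 \<le> card (((T <#> T) - H) \<union> H)"
    using TTc fin' fin_sub by (intro card_mono) auto
  then have cN2: "card N2 \<le> card ((T <#> T) - H) + card H"
    using card_Un_le[of "(T <#> T) - H" H] by linarith
  \<comment> \<open>If \<open>N2\<close> is not the whole group, this is the isoperimetric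
    inequality for \<open>N\<close>. Otherwise it is the inverse-counting bound, \<open>N\<close>
    being asymmetric modulo \<open>H\<close> by \<open>quot\<close>.\<close>
  have big: "2 * card N \<le> card N2 + card H"
  proof (cases "N2 = carrier G")
    case False
    have "card N + \<kappa> \<le> card N2"
      using isoperimetricD[OF K Nc] False HN oneH by (auto simp: N2_def)
    then show ?thesis using \<kappa> by (simp add: N_def)
  next
    case True
    have "2 * card N \<le> card (carrier G) + card H"
    proof (rule card_asymmetric_le[OF Nc])
      fix a b assume ab: "a \<in> N" "b \<in> N" "a \<otimes> b = \<one>"
      then obtain h x h' y where h: "h \<in> H" "x \<in> T" "a = h \<otimes> x" "h' \<in> H" "y \<in> T" "b = h' \<otimes> y"
        unfolding N_def mem_set_mult by blast
      then have c: "h \<in> carrier G" "x \<in> carrier G" "h' \<in> carrier G" "y \<in> carrier G"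
        using Hc Tc by auto
      have "(x \<otimes> y) \<otimes> (h \<otimes> h') = \<one>" using ab(3) h c by (simp add: m_ac)
      then have "inv (h \<otimes> h') = x \<otimes> y" using c by (intro inv_equality) auto
      then have "x \<otimes> y \<in> H" using Hi[of "h \<otimes> h'"] Hm h by simp
      then show "a \<in> H" using quot[of x y] h Hm by simp
    qed (use fin' in auto)
    then show ?thesis using True by simp
  qed
  \<comment> \<open>The holes enter with a positive sign, so equality in the lower bound leaves none
    outside \<open>H\<close>. This one inequality yields both conclusions.\<close>
  have main: "2 * card T + 2 * card D \<le> card (T <#> T) + 1"
    using cTT cN2 big cN IH by linarith
  then show "2 * card T \<le> card (T <#> T) + 1" by simp
  assume "card (T <#> T) + 1 \<le> 2 * card T" and x: "x \<in> T - H"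
  then have "card D = 0" using main by linarith
  then have "D = {}" using fin' by simp
  then have "N \<subseteq> T \<union> H" by (auto simp: D_def)
  then show "H #> x \<subseteq> T"
    using x Tc cosN[of x] mem_r_coset_subgroup_iff[OF H, of x] by blast
qed

text \<open>The bound for proper subgroups is an assumption so that the lemma serves twice: inside
  the induction proving the bound, and afterwards for the classification.\<close>

lemma asym_step:
  assumes T: "asym_set G T" and TT: "T <#> T \<noteq> carrier G"
    and IH: "\<And>H. subgroup H G \<Longrightarrow> H \<noteq> carrier G \<Longrightarrow>
      2 * card (T \<inter> H) \<le> card ((T \<inter> H) <#> (T \<inter> H)) + 1"
  shows "2 * card T \<le> card (T <#> T) + 1"
    and "card (T <#> T) + 1 \<le> 2 * card T \<Longrightarrow>
      \<exists>H \<kappa>. subgroup H G \<and> H \<noteq> carrier G \<and> isoperimetric T \<kappa> \<and> card (H <#> T) = card H + \<kappa> \<and>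
        \<kappa> < card T \<and> (\<forall>x\<in>T - H. H #> x \<subseteq> T)"
proof -
  have Tc: "T \<subseteq> carrier G" and one: "\<one> \<in> T"
    using T by (auto simp: asym_set_def)
  have main: "2 * card T \<le> card (T <#> T) + 1 \<and>
      (\<exists>H \<kappa>. subgroup H G \<and> H \<noteq> carrier G \<and> isoperimetric T \<kappa> \<and> card (H <#> T) = card H + \<kappa> \<and>
        \<kappa> < card T \<and> (\<forall>x\<in>T - H. H #> x \<subseteq> T))"
    if sm: "card (T <#> T) + 1 \<le> 2 * card T"
  proof -
    \<comment> \<open>The possible boundary sizes of non-empty sets that do not fill the group. The
      least one is Hamidoune's connectivity, and \<open>T\<close> itself is a competitor because
      \<open>T <#> T\<close> is not everything.\<close>
    define P where "P k \<longleftrightarrow> (\<exists>X\<subseteq>carrier G. X \<noteq> {} \<and> X <#> T \<noteq> carrier G \<and> card (X <#> T) = card X + k)" for k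
    have P: "P (card (X <#> T) - card X) \<and> card X \<le> card (X <#> T)"
      if "X \<subseteq> carrier G" "X \<noteq> {}" "X <#> T \<noteq> carrier G" for X
    proof -
      have "card X \<le> card (X <#> T)"
        using subset_set_mult[OF one that(1)] set_mult_carrier[OF that(1) Tc]
        by (intro card_mono fin_sub)
      then show ?thesis unfolding P_def using that by (intro conjI exI[of _ X]) auto
    qed
    define \<kappa> where "\<kappa> = (LEAST k. P k)"
    have PT: "P (card (T <#> T) - card T)" and TleTT: "card T \<le> card (T <#> T)"
      using P[OF Tc _ TT] one by auto
    have P\<kappa>: "P \<kappa>" unfolding \<kappa>_def using PT by (rule LeastI)
    have \<kappa>T: "\<kappa> \<le> card (T <#> T) - card T" unfolding \<kappa>_def using PT by (rule Least_le)
    have K: "isoperimetric T \<kappa>"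
      unfolding isoperimetric_def
    proof (intro allI impI)
      fix X assume X: "X \<subseteq> carrier G" "X \<noteq> {}" "X <#> T \<noteq> carrier G"
      have "\<kappa> \<le> card (X <#> T) - card X" unfolding \<kappa>_def using P[OF X] by (intro Least_le) simp
      moreover have "card X \<le> card (X <#> T)" using P[OF X] by simp
      ultimately show "card X + \<kappa> \<le> card (X <#> T)" by linarith
    qed
    \<comment> \<open>As a competitor, \<open>T\<close> gives
      \<open>\<kappa> \<le> card (T <#> T) - card T\<close>, which is at most
      \<open>card T - 1\<close> by \<open>sm\<close>.\<close>
    have small: "\<kappa> < card T" using \<kappa>T sm TleTT one fin_sub[OF Tc] card_gt_0_iff[of T] by auto
    obtain X where X: "X \<subseteq> carrier G" "X \<noteq> {}" "X <#> T \<noteq> carrier G" "card (X <#> T) = card X + \<kappa>"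
      using P\<kappa> by (auto simp: P_def)
    have "X <#> T \<subset> carrier G" using X set_mult_carrier[OF X(1) Tc] by blast
    then have "card (carrier G - (X <#> T)) \<noteq> 0" using fin by auto
    then have "fragment T \<kappa> 1 X"
      using X fin_sub[OF X(1)] by (auto simp: fragment_def Suc_le_eq card_gt_0_iff)
    then obtain H where H: "atom T \<kappa> 1 H" "\<one> \<in> H"
      using atom_normalized[of T \<kappa> 1 X] Tc by blast
    have sub: "subgroup H G" using atom_1_subgroup[OF K H(1) Tc H(2)] .
    have HT: "H <#> T \<noteq> carrier G" and HTle: "card (H <#> T) \<le> card H + \<kappa>" and Hc: "H \<subseteq> carrier G"
      using H by (auto simp: atom_def fragment_def)
    have HTeq: "card (H <#> T) = card H + \<kappa>"
      using isoperimetricD[OF K Hc _ HT] H(2) HTle by force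
    have "H \<subseteq> H <#> T" using one Hc by (rule subset_set_mult)
    then have Hne: "H \<noteq> carrier G" using HT set_mult_carrier[OF Hc Tc] by blast
    note per = small_subgroup_periodic[OF T sub K HTeq small IH[OF sub Hne]]
    show ?thesis using per sm sub Hne K HTeq small by blast
  qed
  then show "2 * card T \<le> card (T <#> T) + 1" by linarith
  show "card (T <#> T) + 1 \<le> 2 * card T \<Longrightarrow>
      \<exists>H \<kappa>. subgroup H G \<and> H \<noteq> carrier G \<and> isoperimetric T \<kappa> \<and> card (H <#> T) = card H + \<kappa> \<and>
        \<kappa> < card T \<and> (\<forall>x\<in>T - H. H #> x \<subseteq> T)"
    using main by blast
qed

lemma finite_comm_group_subgroup:
  assumes "subgroup H G"
  shows "finite_comm_group (G\<lparr>carrier := H\<rparr>)"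
proof -
  interpret H: group "G\<lparr>carrier := H\<rparr>" using assms by (rule subgroup_imp_group)
  interpret H: comm_group "G\<lparr>carrier := H\<rparr>"
    by (rule H.group_comm_groupI) (use subgroup.subset[OF assms] in \<open>auto intro: m_comm\<close>)
  show ?thesis by unfold_locales (use assms fin_sub subgroup.subset in auto)
qed

lemma asym_set_subgroup:
  assumes "asym_set G T" "subgroup H G"
  shows "asym_set (G\<lparr>carrier := H\<rparr>) (T \<inter> H)"
  using assms subgroup.one_closed[OF assms(2)] by (auto simp: asym_set_def)

end

text \<open>If \<open>T\<close> squared is the whole group, counting inverses suffices. Otherwise
  the 1-atom is a proper subgroup, and induction on the group order covers the part of
  \<open>T\<close> inside it.\<close>

lemma card_set_mult_asym:
  assumes "finite_comm_group G" "asym_set G T"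
  shows "2 * card T \<le> card (T <#>\<^bsub>G\<^esub> T) + 1"
  using assms
proof (induction "card (carrier G)" arbitrary: G T rule: less_induct)
  case less
  interpret finite_comm_group G by fact
  note T = less.prems(2)
  show ?case
  proof (cases "T <#>\<^bsub>G\<^esub> T = carrier G")
    case True
    then show ?thesis using asym_set_card_Int[OF T subgroup_self] T
      by (simp add: asym_set_def Int_absorb2)
  next
    case False
    show ?thesis
    proof (rule asym_step(1)[OF T False])
      fix H assume H: "subgroup H G" "H \<noteq> carrier G"
      have "card H < card (carrier G)"
        using H subgroup.subset[OF H(1)] fin by (intro psubset_card_mono) auto
      then show "2 * card (T \<inter> H) \<le> card ((T \<inter> H) <#>\<^bsub>G\<^esub> (T \<inter> H)) + 1"
        using less.hyps[of "G\<lparr>carrier := H\<rparr>" "T \<inter> H"] finite_comm_group_subgroup[OF H(1)]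
          asym_set_subgroup[OF T H(1)] by simp
    qed
  qed
qed

section \<open>Intervals of powers and the classification of extremal asymmetric sets\<close>

context finite_comm_group
begin

lemma asym_set_inv:
  assumes "asym_set G T" "x \<in> T" "inv x \<in> T"
  shows "x = \<one>"
proof -
  have "x \<otimes> inv x = \<one>" using assms by (intro r_inv) (auto simp: asym_set_def)
  then show ?thesis using assms unfolding asym_set_def by blast
qed

lemma generate_singleton:
  "d \<in> carrier G \<Longrightarrow> generate G {d} = {d [^] (k::nat) | k. True}"
  using generate_pow_on_finite_carrier[OF fin] by simp

text \<open>The condition on \<open>inv d\<close> fixes the orientation of the interval.\<close>

lemma asym_interval:
  assumes T: "asym_set G T" and d: "d \<in> carrier G" and inv: "inv d \<notin> T"
    and shift: "card (T \<union> (T #> d)) \<le> card T + 1"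
  shows "x \<in> T - generate G {d} \<Longrightarrow> generate G {d} #> x \<subseteq> T"
    and "\<exists>k < ord d. T \<inter> generate G {d} = {d [^] i | i. i \<le> k}"
proof -
  let ?H = "generate G {d}"
  have Tc: "T \<subseteq> carrier G" and one: "\<one> \<in> T" using T by (auto simp: asym_set_def)
  have finT: "finite T" "finite (T #> d)"
    using Tc d by (simp_all add: fin_sub r_coset_carrier_subset)
  have sub: "subgroup ?H G" using d by (intro generate_is_subgroup) auto
  have Hk: "?H = {d [^] (k::nat) | k. True}" using generate_singleton[OF d] .
  have "card (T \<union> (T #> d)) = card T + card ((T #> d) - T)"
    using card_Un_disjoint[of T "(T #> d) - T"] finT by simp
  then have "card ((T #> d) - T) \<le> 1" using shift by simp
  \<comment> \<open>Multiplication by \<open>d\<close> can leave \<open>T\<close> at one point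
    \<open>e\<close> only.\<close>
  then obtain e where e: "(T #> d) - T \<subseteq> {e}"
    using finT by (metis card_le_Suc0_iff_eq finite_Diff One_nat_def insertI1 subsetI singletonI)
  have step: "x \<otimes> d \<in> T \<or> x \<otimes> d = e" if "x \<in> T" for x
    using that e unfolding subset_iff mem_r_coset Diff_iff by blast
  have n: "ord d \<ge> 1" using ord_ge_1[OF fin d] .
  have invd: "d [^] (ord d - 1) = inv d"
  proof -
    have "d [^] (ord d - 1) \<otimes> d = d [^] Suc (ord d - 1)" by simp
    also have "\<dots> = \<one>" using n d by (simp del: nat_pow_Suc)
    finally show ?thesis using d by (metis inv_equality nat_pow_closed inv_inv inv_closed inv_solve_right l_one)
  qed
  have n2: "ord d \<ge> 2"
  proof (rule ccontr)
    assume "\<not> 2 \<le> ord d"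
    then have "ord d - 1 = 0" by simp
    then show False using invd inv one by simp
  qed
  have ex: "d [^] Suc (ord d - 2) \<notin> T"
  proof -
    have "Suc (ord d - 2) = ord d - 1" using n2 by simp
    then show ?thesis using invd inv by simp
  qed
  \<comment> \<open>\<open>d [^] k\<close> ends the initial run of powers of \<open>d\<close> in
    \<open>T\<close>, so the unique exit \<open>e\<close> is \<open>d [^] Suc k\<close>. The run
    stops by exponent \<open>ord d - 2\<close>, because the next power is \<open>inv d\<close>. As
    \<open>e\<close> lies in \<open>?H\<close>, the other cosets of \<open>?H\<close> are never left
    once entered.\<close>
  define k where "k = (LEAST i. d [^] Suc i \<notin> T)"
  have k: "d [^] Suc k \<notin> T" unfolding k_def using ex by (rule LeastI)
  have kn: "k \<le> ord d - 2" unfolding k_def using ex by (rule Least_le)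
  have low: "d [^] i \<in> T" if "i \<le> k" for i
  proof (cases i)
    case (Suc j)
    then have "j < k" using that by simp
    then show ?thesis using not_less_Least[of j "\<lambda>i. d [^] Suc i \<notin> T"] Suc by (auto simp: k_def)
  qed (use one in simp)
  have ek: "e = d [^] Suc k"
    using step[OF low[of k]] k by simp
  have eH: "e \<in> ?H" using ek Hk by blast
  show "generate G {d} #> x \<subseteq> T" if x: "x \<in> T - generate G {d}"
  proof -
    have xc: "x \<in> carrier G" using x Tc by auto
    have "d [^] i \<otimes> x \<in> T" for i :: nat
    proof (induction i)
      case 0
      then show ?case using x xc by simp
    next
      case (Suc i)
      have eq: "d [^] Suc i \<otimes> x = d [^] i \<otimes> x \<otimes> d" using xc d by (simp add: m_ac)
      have "d [^] Suc i \<in> ?H" using Hk by blast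
      then have "d [^] Suc i \<otimes> x \<in> ?H #> x" unfolding mem_r_coset by blast
      then have "d [^] Suc i \<otimes> x \<noteq> e"
        using mem_r_coset_subgroup_iff[OF sub xc] eH x by blast
      then show ?case using step[OF Suc] eq by simp
    qed
    then show ?thesis unfolding Hk r_coset_def by blast
  qed
  have "T \<inter> ?H = {d [^] i | i. i \<le> k}"
  proof (intro equalityI subsetI)
    fix y assume "y \<in> {d [^] i | i. i \<le> k}"
    then show "y \<in> T \<inter> ?H" using low Hk by blast
  next
    fix y assume y: "y \<in> T \<inter> ?H"
    then have "y \<in> {d [^] x | x. x \<in> (UNIV :: nat set)}" using Hk by blast
    then obtain j where j: "y = d [^] j" "j \<le> ord d - 1"
      unfolding ord_elems[OF fin d] by auto
    \<comment> \<open>A later power of \<open>d\<close> in \<open>T\<close> could be multiplied by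
      \<open>d\<close> up to exponent \<open>ord d - 1\<close> without meeting the exit, which would
      put \<open>inv d\<close> into \<open>T\<close>.\<close>
    have "j \<le> k"
    proof (rule ccontr)
      assume jk: "\<not> j \<le> k"
      have "d [^] i \<in> T" if "j \<le> i" "i \<le> ord d - 1" for i
        using that
      proof (induction i rule: dec_induct)
        case base
        then show ?case using y j by simp
      next
        case (step i)
        have "d [^] Suc i \<noteq> d [^] Suc k"
        proof
          assume "d [^] Suc i = d [^] Suc k"
          moreover have "Suc i \<in> {0..ord d - 1}" "Suc k \<in> {0..ord d - 1}"
            using step.prems kn n2 by auto
          ultimately have "Suc i = Suc k" by (rule inj_onD[OF ord_inj[OF d]])
          then show False using step.hyps jk by simp
        qed
        then show ?case using \<open>\<And>x. x \<in> T \<Longrightarrow> x \<otimes> d \<in> T \<or> x \<otimes> d = e\<close>[of "d [^] i"] step ek by simp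
      qed
      then show False using invd inv j by force
    qed
    then show "y \<in> {d [^] i | i. i \<le> k}" using j by blast
  qed
  then show "\<exists>k < ord d. T \<inter> generate G {d} = {d [^] i | i. i \<le> k}"
    using kn n2 by (intro exI[of _ k]) auto
qed

definition interval_set :: "'a set \<Rightarrow> bool" where
  "interval_set T \<longleftrightarrow> (\<exists>d\<in>carrier G. generate G {d} = carrier G \<and>
     (\<exists>k < ord d. T = {d [^] i | i. i \<le> k}))"

definition periodic_outside :: "'a set \<Rightarrow> 'a set \<Rightarrow> bool" where
  "periodic_outside H T \<longleftrightarrow> subgroup H G \<and> H \<noteq> carrier G \<and> (\<forall>x\<in>T - H. H #> x \<subseteq> T)"

text \<open>Asymmetry keeps one of \<open>d\<close>, \<open>inv d\<close> out of \<open>T\<close>.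
  Replacing \<open>d\<close> by its inverse only translates the union
  \<open>T \<union> (T #> d)\<close>, so the orientation required by \<open>asym_interval\<close>
  can be chosen.\<close>

lemma asym_shift_cases:
  assumes T: "asym_set G T" and d: "d \<in> carrier G" "d \<noteq> \<one>"
    and shift: "card (T \<union> (T #> d)) \<le> card T + 1"
  shows "interval_set T \<or> (\<exists>H. H \<noteq> {\<one>} \<and> periodic_outside H T)"
proof -
  have Tc: "T \<subseteq> carrier G" using T by (auto simp: asym_set_def)
  have *: ?thesis
    if d: "d \<in> carrier G" "d \<noteq> \<one>" "inv d \<notin> T" and shift: "card (T \<union> (T #> d)) \<le> card T + 1" for d
  proof (cases "generate G {d} = carrier G")
    case True
    then show ?thesis
      using asym_interval(2)[OF T d(1,3) shift] d(1) Tc unfolding interval_set_def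
      by (auto simp: Int_absorb2)
  next
    case False
    have "d \<in> generate G {d}" by (simp add: generate.incl)
    then have "generate G {d} \<noteq> {\<one>}" using d(2) by auto
    moreover have "subgroup (generate G {d}) G" using d(1) by (intro generate_is_subgroup) auto
    ultimately show ?thesis
      using asym_interval(1)[OF T d(1,3) shift] False unfolding periodic_outside_def by blast
  qed
  show ?thesis
  proof (cases "inv d \<in> T")
    case False
    then show ?thesis using *[OF d _ shift] by blast
  next
    case True
    have "d \<notin> T" using True asym_set_inv[OF T] d by blast
    moreover have "card (T \<union> (T #> inv d)) \<le> card T + 1"
    proof -
      have c: "T \<union> (T #> inv d) \<subseteq> carrier G"
        using Tc d r_coset_carrier_subset[of "inv d" T] by auto
      have "(T \<union> (T #> inv d)) #> d = (T #> d) \<union> ((T #> inv d) #> d)"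
        by (auto simp: r_coset_def)
      also have "(T #> inv d) #> d = T"
        using Tc d by (simp add: coset_mult_assoc)
      finally have "(T \<union> (T #> inv d)) #> d = T \<union> (T #> d)" by auto
      then show ?thesis using card_r_coset[OF d(1) c] shift by simp
    qed
    moreover have "inv d \<noteq> \<one>" using d by (metis inv_inv inv_one)
    ultimately show ?thesis using *[of "inv d"] d by simp
  qed
qed

theorem asym_structure:
  assumes T: "asym_set G T" and small: "card (T <#> T) + 1 \<le> 2 * card T"
  shows "T = {\<one>} \<or> T <#> T = carrier G \<or> interval_set T \<or> (\<exists>H. H \<noteq> {\<one>} \<and> periodic_outside H T)"
proof (cases "T = {\<one>} \<or> T <#> T = carrier G")
  case False
  have Tc: "T \<subseteq> carrier G" and one: "\<one> \<in> T" using T by (auto simp: asym_set_def)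
  have TTc: "T <#> T \<subseteq> carrier G" using Tc Tc by (rule set_mult_carrier)
  have bound: "2 * card (T \<inter> H) \<le> card ((T \<inter> H) <#> (T \<inter> H)) + 1" if "subgroup H G" for H
    using card_set_mult_asym[OF finite_comm_group_subgroup[OF that] asym_set_subgroup[OF T that]]
    by simp
  have eq: "card (T <#> T) + 1 = 2 * card T"
    using card_set_mult_asym[OF _ T] small finite_comm_group_axioms by fastforce
  obtain H \<kappa> where H: "subgroup H G" "H \<noteq> carrier G" and K: "isoperimetric T \<kappa>"
    and HT: "card (H <#> T) = card H + \<kappa>" and \<kappa>: "\<kappa> < card T" and per: "\<forall>x\<in>T - H. H #> x \<subseteq> T"
    using asym_step(2)[OF T _ bound small] False by blast
  show ?thesis
  proof (cases "H = {\<one>}")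
    case False
    then show ?thesis using H per unfolding periodic_outside_def by blast
  next
    case True
    have "{\<one>} <#> T = T"
      using Tc by (auto simp: set_mult_def) (metis l_one subsetD)
    then have cT: "card T = \<kappa> + 1" using HT True by simp
    have finT: "finite T" using Tc by (rule fin_sub)
    have "card T \<noteq> 1" using False one by (metis card_1_singletonE singletonD)
    then have cT2: "2 \<le> card T" using cT by simp
    show ?thesis
    proof (cases "2 \<le> card (carrier G - (T <#> T))")
      case True
      \<comment> \<open>A trivial 1-atom gives \<open>\<kappa> = card T - 1\<close>, so by
        \<open>eq\<close> the boundary of \<open>T\<close> is exactly \<open>\<kappa>\<close> and
        \<open>T\<close> is a 2-fragment.\<close>
      then have frT: "fragment T \<kappa> 2 T" using cT2 cT eq Tc by (simp add: fragment_def)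
      obtain M where M: "atom T \<kappa> 2 M" "\<one> \<in> M" using atom_normalized[OF frT _ Tc] by auto
      have Mc: "M \<subseteq> carrier G" and M2: "2 \<le> card M" and MT: "card (M <#> T) \<le> card M + \<kappa>"
        and Mne: "M <#> T \<noteq> carrier G"
        using M by (auto simp: atom_def fragment_def)
      show ?thesis
      proof (cases "card M = 2")
        case True
        then obtain d where d: "M = {\<one>, d}" "d \<noteq> \<one>" using M(2) by (auto simp: card_2_iff)
        then have dc: "d \<in> carrier G" using Mc by simp
        have "M <#> T = T <#> M" using Mc Tc by (rule set_mult_comm)
        also have "\<dots> = (T #> \<one>) \<union> (T #> d)" by (auto simp: d set_mult_def r_coset_def)
        finally have "M <#> T = T \<union> (T #> d)" using Tc by simp
        then have "card (T \<union> (T #> d)) \<le> card T + 1" using MT True cT by simp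
        then show ?thesis using asym_shift_cases[OF T dc d(2)] by blast
      next
        case False
        then have M3: "3 \<le> card M" using M2 by simp
        have sub: "subgroup M G" using atom_2_subgroup[OF K M(1) frT cT M(2) M3] .
        have MTeq: "card (M <#> T) = card M + \<kappa>"
          using isoperimetricD[OF K Mc _ Mne] M(2) MT by force
        have "M \<subseteq> M <#> T" using one Mc by (rule subset_set_mult)
        then have "M \<noteq> carrier G" using Mne set_mult_carrier[OF Mc Tc] by blast
        moreover have "M \<noteq> {\<one>}" using M3 by auto
        moreover note small_subgroup_periodic(2)[OF T sub K MTeq \<kappa> bound[OF sub] small]
        ultimately show ?thesis using sub unfolding periodic_outside_def by blast
      qed
    next
      \<comment> \<open>Exactly one element \<open>g\<close> is missing from \<open>T <#> T\<close>.
        Its inverse serves as the shift.\<close>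
      case c1: False
      have "T <#> T \<subset> carrier G" using False TTc by blast
      then obtain g where g: "g \<in> carrier G" "g \<notin> T <#> T" by blast
      have cA: "card (carrier G) \<le> card (T <#> T) + 1"
        using c1 TTc fin by (simp add: card_Diff_subset fin_sub)
      have "\<one> \<in> T <#> T" using subset_set_mult[OF one Tc] one by blast
      then have g1: "inv g \<noteq> \<one>" using g by (metis inv_inv inv_one)
      \<comment> \<open>Apart from \<open>\<one>\<close>, no inverse of an element of
        \<open>T\<close> lies in \<open>T\<close>, by asymmetry. None lies in
        \<open>T #> inv g\<close> either, since \<open>inv t = s \<otimes> inv g\<close> would give
        \<open>g = t \<otimes> s\<close>. The right side has at most \<open>card T + 1\<close>
        elements.\<close>
      have sub: "T \<union> (T #> inv g) \<subseteq> (carrier G - m_inv G ` T) \<union> {\<one>}"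
      proof
        fix x assume x: "x \<in> T \<union> (T #> inv g)"
        have xc: "x \<in> carrier G" using x Tc g r_coset_carrier_subset[of "inv g" T] by auto
        show "x \<in> (carrier G - m_inv G ` T) \<union> {\<one>}"
        proof (cases "x \<in> m_inv G ` T")
          case True
          then obtain t where t: "t \<in> T" "x = inv t" by auto
          have tc: "t \<in> carrier G" using t Tc by auto
          from x show ?thesis
          proof
            assume "x \<in> T"
            then show ?thesis using t tc asym_set_inv[OF T] by auto
          next
            assume "x \<in> T #> inv g"
            then obtain s where s: "s \<in> T" "x = s \<otimes> inv g" unfolding mem_r_coset by blast
            have sc: "s \<in> carrier G" using s Tc by auto
            have "s = x \<otimes> g" using s sc g by (simp add: m_assoc)
            then have "t \<otimes> s = t \<otimes> (inv t \<otimes> g)" using t by simp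
            then have "g = t \<otimes> s" using tc g by (simp flip: m_assoc)
            then show ?thesis using g(2) t s unfolding mem_set_mult by blast
          qed
        qed (use xc in auto)
      qed
      have "card (m_inv G ` T) = card T" using inj_on_subset[OF inv_inj Tc] by (rule card_image)
      moreover have "m_inv G ` T \<subseteq> carrier G" using Tc by auto
      ultimately have "card (carrier G - m_inv G ` T) + card T = card (carrier G)"
        using card_mono[OF fin Tc] by (simp add: card_Diff_subset fin_sub)
      moreover have "card (T \<union> (T #> inv g)) \<le> card (carrier G - m_inv G ` T) + card {\<one>}"
        using card_mono[OF _ sub] fin card_Un_le[of "carrier G - m_inv G ` T" "{\<one>}"] by simp
      ultimately have "card (T \<union> (T #> inv g)) \<le> card T + 1"
        using cA eq by simp
      then show ?thesis using asym_shift_cases[OF T _ g1] g by blast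
    qed
  qed
qed auto

end

section \<open>Isomorphisms and building blocks\<close>

definition pair_iso :: "('a \<Rightarrow> 'b) \<Rightarrow> 'a pair_pre_digraph \<Rightarrow> 'b pair_pre_digraph \<Rightarrow> bool" where
  "pair_iso f G H \<longleftrightarrow> pair_wf_digraph G \<and> pair_wf_digraph H \<and> bij_betw f (pverts G) (pverts H) \<and>
     (\<forall>u\<in>pverts G. \<forall>v\<in>pverts G. (f u, f v) \<in> parcs H \<longleftrightarrow> (u, v) \<in> parcs G)"

definition pair_image :: "('a \<Rightarrow> 'b) \<Rightarrow> 'a pair_pre_digraph \<Rightarrow> 'b pair_pre_digraph" where
  "pair_image f G = \<lparr>pverts = f ` pverts G, parcs = map_prod f f ` parcs G\<rparr>"

lemma pair_wf_digraph_iff: "pair_wf_digraph G \<longleftrightarrow> parcs G \<subseteq> pverts G \<times> pverts G"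
  unfolding pair_wf_digraph_def by fastforce

lemma pair_iso_image:
  assumes "pair_wf_digraph G" "inj_on f (pverts G)"
  shows "pair_iso f G (pair_image f G)"
proof -
  have sub: "parcs G \<subseteq> pverts G \<times> pverts G" using assms(1) by (simp add: pair_wf_digraph_iff)
  have "(u, v) \<in> parcs G"
    if uv: "u \<in> pverts G" "v \<in> pverts G" "(f u, f v) \<in> map_prod f f ` parcs G" for u v
  proof -
    obtain a b where ab: "(a, b) \<in> parcs G" "f u = f a" "f v = f b" using uv(3) by auto
    then have "a \<in> pverts G" "b \<in> pverts G" using sub by auto
    then have "u = a" "v = b" using ab uv(1,2) assms(2) by (auto dest: inj_onD)
    then show ?thesis using ab by simp
  qed
  moreover have img: "map_prod f f ` parcs G \<subseteq> f ` pverts G \<times> f ` pverts G" using sub by auto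
  moreover have "(f u, f v) \<in> map_prod f f ` parcs G" if "(u, v) \<in> parcs G" for u v
    using that by force
  ultimately have "\<forall>u\<in>pverts G. \<forall>v\<in>pverts G.
      (f u, f v) \<in> map_prod f f ` parcs G \<longleftrightarrow> (u, v) \<in> parcs G"
    by (intro ballI iffI)
  then show ?thesis
    using assms img by (simp add: pair_iso_def pair_image_def pair_wf_digraph_iff inj_on_imp_bij_betw)
qed

text \<open>With head and tail fixed as \<open>snd\<close> and \<open>fst\<close>, the arc map of an
  isomorphism is forced to be \<open>map_prod f f\<close>, so the vertex bijection carries all the
  information.\<close>

lemma digraph_iso_iff_pair_iso:
  "digraph_iso (with_proj G) (with_proj H) \<longleftrightarrow> (\<exists>f. pair_iso f G H)"
proof
  assume "digraph_iso (with_proj G) (with_proj H)"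
  then obtain h where h: "pre_digraph.digraph_isomorphism (with_proj G) h"
    and H: "with_proj H = app_iso h (with_proj G)"
    by (auto simp: digraph_iso_def)
  let ?f = "iso_verts h"
  have wf: "pair_wf_digraph G" and inj: "inj_on ?f (pverts G)"
    and ends: "\<And>a. a \<in> parcs G \<Longrightarrow> ?f (fst a) = iso_tail h (iso_arcs h a) \<and>
      ?f (snd a) = iso_head h (iso_arcs h a)"
    using h by (auto simp: pre_digraph.digraph_isomorphism_def wf_digraph_wp_iff)
  have "pverts H = verts (with_proj H)" "parcs H = arcs (with_proj H)"
    "tail (with_proj H) = fst" "head (with_proj H) = snd" by simp_all
  then have V: "pverts H = ?f ` pverts G" and E: "parcs H = iso_arcs h ` parcs G"
    and t: "iso_tail h = fst" and hd: "iso_head h = snd"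
    unfolding H by simp_all
  have "iso_arcs h a = map_prod ?f ?f a" if "a \<in> parcs G" for a
    using ends[OF that] by (auto simp: prod_eq_iff t hd)
  then have "parcs H = map_prod ?f ?f ` parcs G" using E by force
  then have "H = pair_image ?f G" using V by (simp add: pair_image_def)
  then show "\<exists>f. pair_iso f G H" using pair_iso_image[OF wf inj] by blast
next
  assume "\<exists>f. pair_iso f G H"
  then obtain f where f: "pair_iso f G H" by blast
  then have wf: "pair_wf_digraph G" and wfH: "pair_wf_digraph H" and b: "bij_betw f (pverts G) (pverts H)"
    and arc: "\<And>u v. u \<in> pverts G \<Longrightarrow> v \<in> pverts G \<Longrightarrow> (f u, f v) \<in> parcs H \<longleftrightarrow> (u, v) \<in> parcs G"
    by (auto simp: pair_iso_def)
  have sub: "parcs G \<subseteq> pverts G \<times> pverts G" "parcs H \<subseteq> pverts H \<times> pverts H"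
    using wf wfH by (auto simp: pair_wf_digraph_iff)
  have V: "f ` pverts G = pverts H" using b by (auto simp: bij_betw_def)
  have inj: "inj_on f (pverts G)" using b by (auto simp: bij_betw_def)
  have E: "parcs H = map_prod f f ` parcs G"
  proof (intro equalityI subsetI)
    fix a assume a: "a \<in> parcs H"
    then obtain u v where "u \<in> pverts G" "v \<in> pverts G" "a = (f u, f v)"
      using sub V by (cases a) blast
    then show "a \<in> map_prod f f ` parcs G" using arc a by force
  next
    fix a assume "a \<in> map_prod f f ` parcs G"
    then show "a \<in> parcs H" using arc sub by auto
  qed
  have injE: "inj_on (map_prod f f) (parcs G)"
    using map_prod_inj_on[OF inj inj] sub(1) by (rule inj_on_subset)
  let ?h = "\<lparr>iso_verts = f, iso_arcs = map_prod f f, iso_head = snd, iso_tail = fst\<rparr>"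
  have "pre_digraph.digraph_isomorphism (with_proj G) ?h"
    using wf inj injE by (auto simp: pre_digraph.digraph_isomorphism_def wf_digraph_wp_iff)
  moreover have "with_proj H = app_iso ?h (with_proj G)"
    using V E by (simp add: app_iso_def with_proj_def)
  ultimately show "digraph_iso (with_proj G) (with_proj H)" unfolding digraph_iso_def by blast
qed

lemma pair_iso_comp:
  assumes "pair_iso f G H" "pair_iso g H K"
  shows "pair_iso (g \<circ> f) G K"
proof -
  have "bij_betw (g \<circ> f) (pverts G) (pverts K)"
    using assms by (auto simp: pair_iso_def intro: bij_betw_trans)
  moreover have "f u \<in> pverts H" if "u \<in> pverts G" for u
    using assms that by (auto simp: pair_iso_def bij_betw_def)
  ultimately show ?thesis using assms by (simp add: pair_iso_def)
qed

lemma pair_iso_inv: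
  assumes "pair_iso f G H"
  shows "pair_iso (inv_into (pverts G) f) H G"
proof -
  let ?g = "inv_into (pverts G) f"
  have b: "bij_betw f (pverts G) (pverts H)"
    and arc: "\<And>u v. u \<in> pverts G \<Longrightarrow> v \<in> pverts G \<Longrightarrow> (f u, f v) \<in> parcs H \<longleftrightarrow> (u, v) \<in> parcs G"
    using assms by (auto simp: pair_iso_def)
  have "?g u \<in> pverts G" "f (?g u) = u" if "u \<in> pverts H" for u
    using that b bij_betw_inv_into_right[OF b that] by (auto simp: bij_betw_def inv_into_into)
  then have "(?g u, ?g v) \<in> parcs G \<longleftrightarrow> (u, v) \<in> parcs H" if "u \<in> pverts H" "v \<in> pverts H" for u v
    using arc[of "?g u" "?g v"] that by simp
  then show ?thesis
    using assms bij_betw_inv_into[OF b] by (simp add: pair_iso_def)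
qed

lemma constructible_iff: "constructible G \<longleftrightarrow> (\<exists>H f. constructible_nat H \<and> pair_iso f H G)"
  by (auto simp: constructible_def digraph_iso_iff_pair_iso)

lemma constructible_natI:
  "constructible_nat H \<Longrightarrow> pair_iso f H G \<Longrightarrow> constructible G"
  by (auto simp: constructible_iff)

lemma constructible_pair_iso:
  "constructible G \<Longrightarrow> pair_iso f G H \<Longrightarrow> constructible H"
  unfolding constructible_iff using pair_iso_comp by blast

lemma pair_wf_lex_product: "pair_wf_digraph (lex_product D G)"
  by (auto simp: pair_wf_digraph_iff lex_product_def)

lemma pair_iso_lex_product:
  assumes f: "pair_iso f D D'" and g: "pair_iso g G G'"
  shows "pair_iso (map_prod f g) (lex_product D G) (lex_product D' G')"
proof -
  have b: "bij_betw f (pverts D) (pverts D')" "bij_betw g (pverts G) (pverts G')"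
    using f g by (auto simp: pair_iso_def)
  have V: "f u \<in> pverts D'" "g i \<in> pverts G'" if "u \<in> pverts D" "i \<in> pverts G" for u i
    using b that by (auto simp: bij_betw_def)
  have eq: "f u = f v \<longleftrightarrow> u = v" if "u \<in> pverts D" "v \<in> pverts D" for u v
    using b(1) that by (auto simp: bij_betw_def dest: inj_onD)
  have "bij_betw (map_prod f g) (pverts D \<times> pverts G) (pverts D' \<times> pverts G')"
    using b by (rule bij_betw_map_prod)
  then show ?thesis
    using f g V eq by (auto simp: pair_iso_def pair_wf_lex_product) (auto simp: lex_product_def)
qed

text \<open>The product of two copies on natural numbers has pairs as vertices.
  \<open>prod_encode\<close> brings it back to \<open>nat\<close>, where the inductive class
  lives.\<close>

lemma constructible_lex_product:
  assumes "constructible D" "constructible G"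
  shows "constructible (lex_product D G)"
proof -
  obtain D0 f where D0: "constructible_nat D0" "pair_iso f D0 D"
    using assms(1) by (auto simp: constructible_iff)
  obtain G0 g where G0: "constructible_nat G0" "pair_iso g G0 G"
    using assms(2) by (auto simp: constructible_iff)
  let ?L = "lex_product D0 G0"
  have i: "pair_iso prod_encode ?L (pair_image prod_encode ?L)"
    by (intro pair_iso_image pair_wf_lex_product inj_prod_encode)
  then have "constructible_nat (pair_image prod_encode ?L)"
    using constructible_nat.lex_product[OF D0(1) G0(1)] digraph_iso_iff_pair_iso by blast
  then show ?thesis
    using pair_iso_comp[OF pair_iso_inv[OF i] pair_iso_lex_product[OF D0(2) G0(2)]]
    by (rule constructible_natI)
qed

lemma nat_copy:
  assumes "nonempty_digraph G"
  obtains f :: "'a \<Rightarrow> nat" where "pair_iso f G (pair_image f G)" "nonempty_digraph (pair_image f G)"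
proof -
  interpret pair_digraph G using assms by (simp add: nonempty_digraph_def)
  obtain f :: "'a \<Rightarrow> nat" where inj: "inj_on f (pverts G)"
    using finite_imp_inj_to_nat_seg[OF pair_finite_verts] by blast
  have i: "pair_iso f G (pair_image f G)" by (intro pair_iso_image pair_wf_digraph inj)
  interpret I: pair_wf_digraph "pair_image f G" using i by (simp add: pair_iso_def)
  have "pair_digraph (pair_image f G)"
  proof
    fix e assume "e \<in> parcs (pair_image f G)"
    then obtain u v where "(u, v) \<in> parcs G" "e = (f u, f v)" by (auto simp: pair_image_def)
    then show "fst e \<noteq> snd e" using no_loops'[of u v] inj_onD[OF inj, of u v] wellformed'[of u v] by auto
  qed (use pair_finite_verts pair_finite_arcs in \<open>auto simp: pair_image_def\<close>)
  then show ?thesis using that[OF i] assms by (simp add: nonempty_digraph_def pair_image_def)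
qed

lemma constructible_empty_graph:
  assumes "empty_graph G" shows "constructible G"
proof -
  obtain f :: "'a \<Rightarrow> nat" where f: "pair_iso f G (pair_image f G)" "nonempty_digraph (pair_image f G)"
    using nat_copy assms by (auto simp: empty_graph_def)
  then have "empty_graph (pair_image f G)" using assms by (simp add: empty_graph_def pair_image_def)
  then show ?thesis using constructible_natI[OF constructible_nat.empty pair_iso_inv[OF f(1)]] by simp
qed

lemma out_degree_eq_card_N1: "out_degree (with_proj G) v = card (N1 G v)"
proof -
  have "out_arcs (with_proj G) v = Pair v ` N1 G v" by (auto simp: out_arcs_def N1_def)
  then show ?thesis by (simp add: out_degree_def card_image inj_on_def)
qed

lemma constructible_regular_tournament:
  assumes G: "regular_tournament G" shows "constructible G"
proof -
  have orient: "orientation G" and nonempty: "nonempty_digraph G"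
    using G by (auto simp: regular_tournament_def tournament_def orientation_def)
  obtain f :: "'a \<Rightarrow> nat" where f: "pair_iso f G (pair_image f G)" "nonempty_digraph (pair_image f G)"
    using nat_copy[OF nonempty] by auto
  let ?H = "pair_image f G"
  have V: "pverts ?H = f ` pverts G" by (simp add: pair_image_def)
  have wf: "parcs G \<subseteq> pverts G \<times> pverts G" "parcs ?H \<subseteq> pverts ?H \<times> pverts ?H"
    and arc: "\<And>u v. u \<in> pverts G \<Longrightarrow> v \<in> pverts G \<Longrightarrow> (f u, f v) \<in> parcs ?H \<longleftrightarrow> (u, v) \<in> parcs G"
    and inj: "inj_on f (pverts G)"
    using f(1) by (auto simp: pair_iso_def pair_wf_digraph_iff bij_betw_def)
  have "orientation ?H"
    unfolding orientation_def
  proof (intro conjI allI impI f(2))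
    fix a b assume ab: "(a, b) \<in> parcs ?H"
    then obtain u v where "u \<in> pverts G" "v \<in> pverts G" "a = f u" "b = f v" using wf(2) V by auto
    then show "(b, a) \<notin> parcs ?H" using ab arc orient by (simp add: orientation_def)
  qed
  moreover have "\<forall>a\<in>pverts ?H. \<forall>b\<in>pverts ?H. a \<noteq> b \<longrightarrow> (a, b) \<in> parcs ?H \<or> (b, a) \<in> parcs ?H"
    using G arc by (auto simp: V regular_tournament_def tournament_def)
  moreover have "card (N1 ?H (f u)) = card (N1 G u)" if u: "u \<in> pverts G" for u
  proof -
    have "N1 ?H (f u) \<subseteq> f ` N1 G u"
    proof
      fix b assume b: "b \<in> N1 ?H (f u)"
      then obtain v where "v \<in> pverts G" "b = f v" using wf(2) V by (auto simp: N1_def)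
      then show "b \<in> f ` N1 G u" using b arc u by (auto simp: N1_def)
    qed
    moreover have "f ` N1 G u \<subseteq> N1 ?H (f u)" using arc u wf(1) by (auto simp: N1_def)
    ultimately have "N1 ?H (f u) = f ` N1 G u" by blast
    moreover have "inj_on f (N1 G u)" by (rule inj_on_subset[OF inj]) (use wf in \<open>auto simp: N1_def\<close>)
    ultimately show ?thesis by (simp add: card_image)
  qed
  moreover obtain d where "\<forall>u\<in>pverts G. card (N1 G u) = d"
    using G by (auto simp: regular_tournament_def out_degree_eq_card_N1)
  ultimately have "regular_tournament ?H"
    unfolding regular_tournament_def tournament_def out_degree_eq_card_N1 V by auto
  then show ?thesis
    using constructible_natI[OF constructible_nat.regular_tournament pair_iso_inv[OF f(1)]] by simp
qed

section \<open>Powers of directed cycles in modular arithmetic\<close>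

lemma mod_add_inj:
  fixes i a b n :: nat
  assumes "(i + a) mod n = (i + b) mod n" "a < n" "b < n"
  shows "a = b"
  using assms
proof (induction a b rule: linorder_wlog)
  case (le a b)
  then have "n dvd (i + b) - (i + a)" by (subst mod_eq_dvd_iff_nat[symmetric]) auto
  then have "n dvd b - a" by simp
  then show ?case using le dvd_imp_le[of n "b - a"] by (cases "b - a = 0") auto
qed simp

lemma directed_cycle_walk_end:
  assumes "pcas u p w" "set p \<subseteq> parcs (directed_cycle n)" "u < n"
  shows "w = (u + length p) mod n"
  using assms
proof (induction p arbitrary: u)
  case (Cons e p)
  then have e: "e = (u, (u + 1) mod n)" by (auto simp: directed_cycle_def)
  have "w = ((u + 1) mod n + length p) mod n" using Cons e by auto
  then show ?case by (simp add: mod_add_left_eq)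
qed auto

text \<open>The vertex list is recorded because the power is defined by paths, so distinctness of
  the visited vertices has to be checked.\<close>

lemma directed_cycle_walk_exists:
  assumes "u < n"
  shows "\<exists>p. pcas u p ((u + j) mod n) \<and> set p \<subseteq> parcs (directed_cycle n) \<and> length p = j \<and>
    pawalk_verts u p = map (\<lambda>t. (u + t) mod n) [0..<Suc j]"
  using assms
proof (induction j arbitrary: u)
  case (Suc j)
  let ?v = "(u + 1) mod n"
  have v: "?v < n" using Suc.prems by simp
  have shift: "(?v + t) mod n = (u + Suc t) mod n" for t by (simp add: mod_add_left_eq)
  obtain p where p: "pcas ?v p ((?v + j) mod n)" "set p \<subseteq> parcs (directed_cycle n)" "length p = j"
    "pawalk_verts ?v p = map (\<lambda>t. (?v + t) mod n) [0..<Suc j]"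
    using Suc.IH[OF v] by blast
  have "map (\<lambda>t. (u + t) mod n) [0..<Suc (Suc j)] =
      (u + 0) mod n # map (\<lambda>t. (u + Suc t) mod n) [0..<Suc j]"
    by (simp only: upt_conv_Cons[of 0 "Suc (Suc j)"] map_Suc_upt[symmetric] list.map list.map_comp
        comp_def)
  then show ?case
    using p Suc.prems unfolding shift
    by (intro exI[of _ "(u, ?v) # p"]) (auto simp: directed_cycle_def)
qed auto

lemma parcs_directed_cycle_power:
  assumes "k < n"
  shows "parcs (digraph_power (directed_cycle n) k) =
    {(i, (i + j) mod n) | i j. i < n \<and> 1 \<le> j \<and> j \<le> k}"
proof -
  let ?C = "directed_cycle n"
  have apath: "pre_digraph.apath (with_proj ?C) u p w \<longleftrightarrow>
      u < n \<and> set p \<subseteq> parcs ?C \<and> pcas u p w \<and> distinct (pawalk_verts u p)" for u p w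
    unfolding pre_digraph.apath_def pre_digraph.awalk_def cas_with_proj_eq awalk_verts_with_proj_eq
    by (auto simp: directed_cycle_def)
  show ?thesis
  proof (intro equalityI subsetI)
    fix a assume "a \<in> parcs (digraph_power ?C k)"
    then obtain u w p where a: "a = (u, w)" "u \<noteq> w" "length p \<le> k"
      and p: "u < n" "set p \<subseteq> parcs ?C" "pcas u p w"
      by (auto simp: digraph_power_def apath)
    have "w = (u + length p) mod n" using directed_cycle_walk_end p by blast
    moreover have "p \<noteq> []" using a p by auto
    ultimately show "a \<in> {(i, (i + j) mod n) | i j. i < n \<and> 1 \<le> j \<and> j \<le> k}"
      using a p(1) by (auto simp: Suc_le_eq intro!: exI[of _ "length p"])
  next
    fix a assume "a \<in> {(i, (i + j) mod n) | i j. i < n \<and> 1 \<le> j \<and> j \<le> k}"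
    then obtain i j where a: "a = (i, (i + j) mod n)" "i < n" "1 \<le> j" "j \<le> k" by blast
    obtain p where p: "pcas i p ((i + j) mod n)" "set p \<subseteq> parcs ?C" "length p = j"
      "pawalk_verts i p = map (\<lambda>t. (i + t) mod n) [0..<Suc j]"
      using directed_cycle_walk_exists[OF a(2)] by blast
    \<comment> \<open>At most \<open>k < n\<close> steps cannot wrap around the cycle.\<close>
    have "distinct (pawalk_verts i p)"
      unfolding p(4) distinct_map
      using a(4) assms by (auto intro!: inj_onI dest: mod_add_inj)
    moreover have "i \<noteq> (i + j) mod n"
      using mod_add_inj[of i 0 n j] a assms by auto
    ultimately show "a \<in> parcs (digraph_power ?C k)"
      unfolding digraph_power_def using a p apath by auto
  qed
qed

lemma constructible_cycle_power:
  fixes n k :: nat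
  assumes n: "1 \<le> k" "2 * k < n" and wf: "pair_wf_digraph G"
    and f: "bij_betw f {..<n} (pverts G)"
    and arc: "\<And>i i'. i < n \<Longrightarrow> i' < n \<Longrightarrow> (f i, f i') \<in> parcs G \<longleftrightarrow> (\<exists>j. 1 \<le> j \<and> j \<le> k \<and> i' = (i + j) mod n)"
  shows "constructible G"
proof (rule constructible_natI[OF constructible_nat.cycle_power[of n k]])
  let ?C = "digraph_power (directed_cycle n) k"
  have V: "pverts ?C = {..<n}" by (simp add: digraph_power_def directed_cycle_def)
  have E: "parcs ?C = {(i, (i + j) mod n) | i j. i < n \<and> 1 \<le> j \<and> j \<le> k}"
    using n by (intro parcs_directed_cycle_power) simp
  have "pair_wf_digraph ?C" using n by (auto simp: pair_wf_digraph_iff V E)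
  then show "pair_iso f ?C G"
    unfolding pair_iso_def V E using wf f arc by auto
qed (use n in auto)

section \<open>Cayley digraphs\<close>

lemma cayley_arc:
  "(a, b) \<in> parcs (cayley_digraph G S) \<longleftrightarrow> a \<in> carrier G \<and> (\<exists>s\<in>S. b = a \<otimes>\<^bsub>G\<^esub> s)"
  by (auto simp: cayley_digraph_def)

lemma pverts_cayley [simp]: "pverts (cayley_digraph G S) = carrier G"
  by (simp add: cayley_digraph_def)

context finite_comm_group
begin

lemma cayley_arc_iff:
  assumes "a \<in> carrier G" "b \<in> carrier G" "S \<subseteq> carrier G"
  shows "(a, b) \<in> parcs (cayley_digraph G S) \<longleftrightarrow> b \<otimes> inv a \<in> S"
proof -
  have "b = a \<otimes> s \<longleftrightarrow> b \<otimes> inv a = s" if "s \<in> S" for s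
  proof -
    have s: "s \<in> carrier G" using that assms by auto
    show ?thesis using assms(1,2) s inv_solve_right[of s b a] m_comm[of a s] by auto
  qed
  then show ?thesis using assms(1) by (auto simp: cayley_arc)
qed

lemma nonempty_digraph_cayley:
  assumes "S \<subseteq> carrier G - {\<one>}"
  shows "nonempty_digraph (cayley_digraph G S)"
proof -
  have sub: "parcs (cayley_digraph G S) \<subseteq> carrier G \<times> carrier G"
    using assms by (auto simp: cayley_digraph_def)
  have f: "finite (parcs (cayley_digraph G S))"
    using finite_subset[OF sub] fin by simp
  have "pair_digraph (cayley_digraph G S)"
  proof
    fix e assume e: "e \<in> parcs (cayley_digraph G S)"
    show "fst e \<in> pverts (cayley_digraph G S)" "snd e \<in> pverts (cayley_digraph G S)"
      using e sub by auto
    show "fst e \<noteq> snd e" using e assms by (auto simp: cayley_digraph_def)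
  qed (use f fin in auto)
  then show ?thesis by (auto simp: nonempty_digraph_def)
qed

lemma pair_wf_cayley:
  "S \<subseteq> carrier G - {\<one>} \<Longrightarrow> pair_wf_digraph (cayley_digraph G S)"
  by (auto simp: pair_wf_digraph_iff cayley_digraph_def)

lemma orientation_cayley:
  assumes T: "asym_set G T"
  shows "orientation (cayley_digraph G (T - {\<one>}))"
proof -
  have Tc: "T \<subseteq> carrier G" using T by (auto simp: asym_set_def)
  have "(b, a) \<notin> parcs (cayley_digraph G (T - {\<one>}))"
    if ab: "(a, b) \<in> parcs (cayley_digraph G (T - {\<one>}))" for a b
  proof
    assume ba: "(b, a) \<in> parcs (cayley_digraph G (T - {\<one>}))"
    obtain s t where s: "s \<in> T - {\<one>}" "b = a \<otimes> s" and t: "t \<in> T - {\<one>}" "a = b \<otimes> t"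
      and ac: "a \<in> carrier G"
      using ab ba unfolding cayley_arc by blast
    have c: "s \<in> carrier G" "t \<in> carrier G" using s t Tc by auto
    have "a = a \<otimes> s \<otimes> t" using t(2) by (simp only: s(2))
    then have "a = a \<otimes> (s \<otimes> t)" using c ac by (simp add: m_assoc)
    then have "s \<otimes> t = \<one>" using l_cancel_one'[of a "s \<otimes> t"] ac c by simp
    then show False using T s t unfolding asym_set_def by blast
  qed
  moreover have "T - {\<one>} \<subseteq> carrier G - {\<one>}" using Tc by auto
  ultimately show ?thesis
    unfolding orientation_def using nonempty_digraph_cayley by blast
qed

text \<open>Here \<open>card (carrier G) + 1 \<le> 2 * card T\<close>, while \<open>T\<close> and
  its inverses share only \<open>\<one>\<close>. So they cover the group, and any two vertices are
  joined. Out-regularity comes from left translation.\<close>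

lemma constructible_full:
  assumes T: "asym_set G T" and TT: "T <#> T = carrier G" and small: "card (T <#> T) + 1 \<le> 2 * card T"
  shows "constructible (cayley_digraph G (T - {\<one>}))"
proof (rule constructible_regular_tournament)
  let ?C = "cayley_digraph G (T - {\<one>})"
  have Tc: "T \<subseteq> carrier G" and one: "\<one> \<in> T" using T by (auto simp: asym_set_def)
  have finT: "finite T" using Tc by (rule fin_sub)
  have "T \<inter> m_inv G ` T \<subseteq> {\<one>}"
  proof
    fix x assume "x \<in> T \<inter> m_inv G ` T"
    then obtain t where "t \<in> T" "x = inv t" "inv t \<in> T" by auto
    then show "x \<in> {\<one>}" using asym_set_inv[OF T, of t] by auto
  qed
  then have "card (T \<inter> m_inv G ` T) \<le> 1" using card_mono[of "{\<one>}"] by fastforce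
  moreover have "card (m_inv G ` T) = card T" using inj_on_subset[OF inv_inj Tc] by (rule card_image)
  ultimately have "card (carrier G) \<le> card (T \<union> m_inv G ` T)"
    using card_Un_Int[of T "m_inv G ` T"] finT TT small by simp
  then have all: "T \<union> m_inv G ` T = carrier G"
    using Tc by (intro card_seteq fin) auto
  have "(a, b) \<in> parcs ?C \<or> (b, a) \<in> parcs ?C"
    if ab: "a \<in> carrier G" "b \<in> carrier G" "a \<noteq> b" for a b
  proof -
    have ne: "b \<otimes> inv a \<noteq> \<one>"
    proof
      assume "b \<otimes> inv a = \<one>"
      then have "inv (inv a) = b" using ab by (intro inv_equality) auto
      then show False using ab by simp
    qed
    have "b \<otimes> inv a \<in> T \<union> m_inv G ` T" using all ab by simp
    then show ?thesis
    proof
      assume "b \<otimes> inv a \<in> T"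
      then show ?thesis using ab ne Tc by (subst cayley_arc_iff) auto
    next
      assume "b \<otimes> inv a \<in> m_inv G ` T"
      then obtain t where t: "t \<in> T" "b \<otimes> inv a = inv t" by auto
      then have "t = inv (b \<otimes> inv a)" using Tc by auto
      also have "\<dots> = a \<otimes> inv b" using ab by (simp add: inv_mult_group)
      finally have "a \<otimes> inv b \<in> T" "a \<otimes> inv b \<noteq> \<one>" using t ne by auto
      then show ?thesis using ab Tc cayley_arc_iff[of b a "T - {\<one>}"] by auto
    qed
  qed
  moreover have "card (N1 ?C v) = card (T - {\<one>})" if v: "v \<in> carrier G" for v
  proof -
    have "N1 ?C v = (\<lambda>s. v \<otimes> s) ` (T - {\<one>})" using v by (auto simp: N1_def cayley_arc)
    moreover have "inj_on (\<lambda>s. v \<otimes> s) (T - {\<one>})" using v Tc by (intro inj_onI) (auto simp: subset_iff)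
    ultimately show ?thesis by (simp add: card_image)
  qed
  ultimately show "regular_tournament ?C"
    using orientation_cayley[OF T]
    by (simp add: regular_tournament_def tournament_def out_degree_eq_card_N1)
qed

lemma pow_mod_ord:
  assumes "d \<in> carrier G"
  shows "d [^] (a mod ord d) = d [^] (a :: nat)"
proof -
  have "d [^] a = d [^] (a mod ord d + ord d * (a div ord d))" by simp
  also have "\<dots> = d [^] (a mod ord d) \<otimes> (d [^] ord d) [^] (a div ord d)"
    using assms by (simp only: nat_pow_mult[symmetric] nat_pow_pow)
  finally show ?thesis using assms by simp
qed

text \<open>Exponents of the generator \<open>d\<close> identify the group with the integers modulo
  \<open>ord d\<close>. The condition \<open>2 * k < ord d\<close> is the inverse-counting bound for
  \<open>card T = k + 1\<close>.\<close>

lemma constructible_interval: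
  assumes T: "asym_set G T" and int: "interval_set T" and ne: "T \<noteq> {\<one>}"
  shows "constructible (cayley_digraph G (T - {\<one>}))"
proof -
  obtain d k where d: "d \<in> carrier G" "generate G {d} = carrier G" and k: "k < ord d"
    and Teq: "T = {d [^] i | i. i \<le> k}"
    using int by (auto simp: interval_set_def)
  let ?n = "ord d"
  have n: "card (carrier G) = ?n" using generate_pow_card[OF d(1)] d(2) by simp
  have inj: "a = b" if "d [^] a = d [^] b" "a < ?n" "b < ?n" for a b :: nat
    using inj_onD[OF ord_inj[OF d(1)] that(1)] that(2,3) by auto
  have Tc: "T \<subseteq> carrier G" using T by (auto simp: asym_set_def)
  have "k \<noteq> 0"
  proof
    assume "k = 0"
    then have "T = {\<one>}" using Teq by auto
    then show False using ne by simp
  qed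
  then have k1: "1 \<le> k" by simp
  have "T = (\<lambda>i. d [^] i) ` {..k}" using Teq by auto
  moreover have "inj_on (\<lambda>i. d [^] i) {..k}" using inj k by (auto intro!: inj_onI)
  ultimately have "card T = k + 1" by (simp add: card_image)
  moreover have "2 * card T \<le> card (carrier G) + 1"
    using asym_set_card_Int[OF T subgroup_self] Tc by (simp add: Int_absorb2)
  ultimately have kn: "2 * k < ?n" using n by simp
  show ?thesis
  proof (rule constructible_cycle_power[OF k1 kn pair_wf_cayley])
    show "T - {\<one>} \<subseteq> carrier G - {\<one>}" using Tc by auto
    have injn: "inj_on (\<lambda>i. d [^] i) {..<?n}" using inj by (auto intro!: inj_onI)
    have "(\<lambda>i. d [^] i) ` {..<?n} = carrier G"
      using d(1) n injn fin by (intro card_subset_eq) (auto simp: card_image)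
    then show "bij_betw (\<lambda>i. d [^] i) {..<?n} (pverts (cayley_digraph G (T - {\<one>})))"
      using injn by (simp add: bij_betw_def)
    fix i i' assume i: "i < ?n" "i' < ?n"
    show "(d [^] i, d [^] i') \<in> parcs (cayley_digraph G (T - {\<one>})) \<longleftrightarrow>
        (\<exists>j. 1 \<le> j \<and> j \<le> k \<and> i' = (i + j) mod ?n)" (is "?L \<longleftrightarrow> ?R")
    proof
      assume ?L
      then obtain s where s: "s \<in> T" "s \<noteq> \<one>" "d [^] i' = d [^] i \<otimes> s" unfolding cayley_arc by blast
      then obtain j where j: "j \<le> k" "s = d [^] j" using Teq by auto
      have "j \<noteq> 0" using s j by (cases j) auto
      moreover have "d [^] i' = d [^] ((i + j) mod ?n)"
        using s(3) j d(1) by (simp add: pow_mod_ord nat_pow_mult)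
      then have "i' = (i + j) mod ?n" using i by (intro inj) auto
      ultimately show ?R using j by (intro exI[of _ j]) auto
    next
      assume ?R
      then obtain j where j: "1 \<le> j" "j \<le> k" "i' = (i + j) mod ?n" by blast
      have "d [^] j \<noteq> d [^] (0::nat)" using inj[of j 0] j k by auto
      then have "d [^] j \<in> T - {\<one>}" using j Teq by auto
      moreover have "d [^] i' = d [^] i \<otimes> d [^] j"
        using j d(1) by (simp add: pow_mod_ord nat_pow_mult)
      ultimately show ?L unfolding cayley_arc using d(1) by blast
    qed
  qed
qed

lemma constructible_primitive:
  assumes T: "asym_set G T" and small: "card (T <#> T) + 1 \<le> 2 * card T"
    and prim: "\<And>H. periodic_outside H T \<Longrightarrow> H = {\<one>}"
  shows "constructible (cayley_digraph G (T - {\<one>}))"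
proof (cases "T = {\<one>}")
  case True
  then show ?thesis
    using nonempty_digraph_cayley[of "{}"]
    by (intro constructible_empty_graph) (simp add: empty_graph_def cayley_digraph_def)
next
  case False
  then consider "T <#> T = carrier G" | "interval_set T"
    using asym_structure[OF T small] prim by blast
  then show ?thesis
    using constructible_full[OF T _ small] constructible_interval[OF T _ False] by cases auto
qed

end

section \<open>The quotient by a periodicity subgroup and the lexicographic decomposition\<close>

locale periodic_quotient = finite_comm_group +
  fixes H T
  assumes asym: "asym_set G T" and per: "periodic_outside H T"
begin

abbreviation Q where "Q \<equiv> G Mod H"
abbreviation T' where "T' \<equiv> (\<lambda>x. H #> x) ` T"

lemma sub: "subgroup H G" and Hne: "H \<noteq> carrier G"
  and perD: "x \<in> T \<Longrightarrow> x \<notin> H \<Longrightarrow> H #> x \<subseteq> T"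
  using per by (auto simp: periodic_outside_def)

lemma Hc: "H \<subseteq> carrier G" and Tc: "T \<subseteq> carrier G" and one_T: "\<one> \<in> T" and one_H: "\<one> \<in> H"
  using sub subgroup.subset subgroup.one_closed asym by (auto simp: asym_set_def)

lemma normal: "H \<lhd> G"
  by (simp add: sub normal_iff_subgroup)

lemma carrier_Q: "carrier Q = (\<lambda>x. H #> x) ` carrier G"
  by (rule carrier_FactGroup)

sublocale Q: finite_comm_group Q
proof -
  interpret Q: comm_group Q by (rule abelian_FactGroup[OF sub])
  show "finite_comm_group Q"
    by unfold_locales (simp add: carrier_Q fin)
qed

lemma coset_eq_iff:
  assumes "x \<in> carrier G" "y \<in> carrier G"
  shows "H #> x = H #> y \<longleftrightarrow> x \<in> H #> y"
  using assms sub repr_independence[of x H y] rcos_self[of x H] by metis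

lemma coset_eq_H_iff: "x \<in> carrier G \<Longrightarrow> H #> x = H \<longleftrightarrow> x \<in> H"
  using coset_join1 coset_join2 sub by blast

lemma coset_mult: "x \<in> carrier G \<Longrightarrow> y \<in> carrier G \<Longrightarrow> (H #> x) <#> (H #> y) = H #> (x \<otimes> y)"
  using normal.rcos_sum[OF normal] .

text \<open>Off \<open>H\<close>, periodicity makes \<open>T\<close> the full preimage of its image
  in the quotient.\<close>

lemma coset_in_T'_iff:
  assumes x: "x \<in> carrier G" "x \<notin> H"
  shows "H #> x \<in> T' \<longleftrightarrow> x \<in> T"
proof
  assume "H #> x \<in> T'"
  then obtain t where t: "t \<in> T" "H #> x = H #> t" by auto
  then have "x \<in> H #> t" using coset_eq_iff x Tc by blast
  moreover from this have "t \<notin> H" using mem_r_coset_subgroup_iff[OF sub, of t x] t Tc x by blast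
  ultimately show "x \<in> T" using perD t by blast
qed auto

lemma asym_quotient: "asym_set Q T'"
proof -
  have "H #> x = H" if xy: "x \<in> T" "y \<in> T" "(H #> x) <#> (H #> y) = H" for x y
  proof (rule ccontr)
    assume ne: "H #> x \<noteq> H"
    have c: "x \<in> carrier G" "y \<in> carrier G" using xy Tc by auto
    have xH: "x \<notin> H" using ne coset_eq_H_iff c by simp
    have xyH: "x \<otimes> y \<in> H" using xy(3) coset_mult coset_eq_H_iff c by simp
    \<comment> \<open>This element equals \<open>inv y\<close>, and the whole coset
      \<open>H #> x\<close> lies in \<open>T\<close>. Thus \<open>T\<close> contains
      \<open>y\<close> and \<open>inv y\<close>, so \<open>y = \<one>\<close>.\<close>
    have "inv (x \<otimes> y) \<otimes> x \<in> H #> x"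
      using subgroup.m_inv_closed[OF sub xyH] unfolding mem_r_coset by blast
    moreover have "inv (x \<otimes> y) \<otimes> x = inv y"
      using c by (simp add: inv_mult_group m_assoc)
    ultimately have "inv y \<in> T" using perD xy xH by auto
    then have "y = \<one>" using asym_set_inv[OF asym] xy by blast
    then show False using xyH xH c by simp
  qed
  moreover have "H \<in> T'" using one_T coset_eq_H_iff[of \<one>] one_H by force
  ultimately show ?thesis
    using Tc unfolding asym_set_def by (auto simp: carrier_Q)
qed

lemma card_Union_cosets:
  assumes "C \<subseteq> carrier Q"
  shows "card (\<Union>C) = card H * card C"
proof -
  have C: "\<exists>x\<in>carrier G. X = H #> x" if "X \<in> C" for X
    using assms that by (auto simp: carrier_Q)
  have sub': "\<Union>C \<subseteq> carrier G"
    using C r_coset_carrier_subset[OF _ Hc] by blast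
  have "card H * card C = card (\<Union>C)"
  proof (rule card_partition)
    show "finite C" using assms Q.fin finite_subset by blast
    show "finite (\<Union>C)" using sub' by (rule fin_sub)
    show "card X = card H" if "X \<in> C" for X using C[OF that] card_r_coset Hc by auto
    show "X \<inter> Y = {}" if XY: "X \<in> C" "Y \<in> C" "X \<noteq> Y" for X Y
    proof (rule ccontr)
      assume "X \<inter> Y \<noteq> {}"
      then obtain z where z: "z \<in> X" "z \<in> Y" by blast
      obtain x y where xy: "x \<in> carrier G" "X = H #> x" "y \<in> carrier G" "Y = H #> y"
        using C[OF XY(1)] C[OF XY(2)] by blast
      have "z \<in> carrier G" using z(1) C[OF XY(1)] r_coset_carrier_subset[OF _ Hc] by blast
      then have "H #> z = X" "H #> z = Y" using coset_eq_iff z xy by blast+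
      then show False using XY by simp
    qed
  qed
  then show ?thesis by simp
qed

text \<open>Let \<open>m\<close> and \<open>M\<close> count the cosets other than \<open>H\<close>
  in \<open>T'\<close> and in its square. The excess \<open>|T T| - 2 |T| + 1\<close> is at least
  \<open>card H * (M - 2 * m)\<close> plus the corresponding excess of \<open>T \<inter> H\<close>.
  Both terms are non-negative by the lower bound, so a non-positive sum makes both vanish.\<close>

lemma card_set_mult_factors:
  assumes small: "card (T <#> T) + 1 \<le> 2 * card T"
  shows "card (T' <#>\<^bsub>Q\<^esub> T') + 1 \<le> 2 * card T'"
    and "card ((T \<inter> H) <#> (T \<inter> H)) + 1 \<le> 2 * card (T \<inter> H)"
proof -
  have T'c: "T' \<subseteq> carrier Q" and HT': "H \<in> T'"
    using asym_quotient by (auto simp: asym_set_def)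
  have TT'c: "T' <#>\<^bsub>Q\<^esub> T' \<subseteq> carrier Q" using T'c T'c by (rule Q.set_mult_carrier)
  have oneT': "\<one>\<^bsub>Q\<^esub> \<in> T'" using asym_quotient by (simp only: asym_set_def)
  have HTT': "H \<in> T' <#>\<^bsub>Q\<^esub> T'" by (rule subsetD[OF Q.subset_set_mult[OF oneT' T'c] HT'])
  have fins: "finite T'" "finite (T' <#>\<^bsub>Q\<^esub> T')" "finite T"
    using T'c TT'c Q.fin_sub fin_sub Tc by auto
  have TTc: "T <#> T \<subseteq> carrier G" using Tc Tc by (rule set_mult_carrier)
  have finTT: "finite (T <#> T)" using TTc by (rule fin_sub)
  obtain m where m: "card T' = Suc m" "card (T' - {H}) = m"
    using HT' fins(1) card_Suc_Diff1 by metis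
  obtain M where M: "card (T' <#>\<^bsub>Q\<^esub> T') = Suc M" "card ((T' <#>\<^bsub>Q\<^esub> T') - {H}) = M"
    using HTT' fins(2) card_Suc_Diff1 by metis
  have "T \<subseteq> \<Union>(T' - {H}) \<union> (T \<inter> H)"
  proof
    fix x assume x: "x \<in> T"
    then have "x \<in> carrier G" using Tc by auto
    then have "x \<in> H #> x" "x \<notin> H \<Longrightarrow> H #> x \<noteq> H"
      using rcos_self sub coset_eq_H_iff by auto
    then show "x \<in> \<Union>(T' - {H}) \<union> (T \<inter> H)" using x by blast
  qed
  moreover have "\<Union>(T' - {H}) \<subseteq> carrier G"
    using r_coset_carrier_subset[OF _ Hc] Tc by blast
  ultimately have "card T \<le> card (\<Union>(T' - {H}) \<union> (T \<inter> H))"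
    using Tc by (intro card_mono fin_sub) auto
  also have "\<dots> \<le> card (\<Union>(T' - {H})) + card (T \<inter> H)" by (rule card_Un_le)
  also have "card (\<Union>(T' - {H})) = card H * m"
    using card_Union_cosets[of "T' - {H}"] T'c m by auto
  finally have cT: "card T \<le> card H * m + card (T \<inter> H)" .
  \<comment> \<open>For a product coset other than \<open>H\<close>, at least one factor lies
    outside \<open>H\<close>. Its entire coset belongs to \<open>T\<close> and can absorb any
    \<open>h \<in> H\<close>.\<close>
  have union: "\<Union>((T' <#>\<^bsub>Q\<^esub> T') - {H}) \<subseteq> (T <#> T) - H"
  proof
    fix z assume "z \<in> \<Union>((T' <#>\<^bsub>Q\<^esub> T') - {H})"
    then obtain X where X: "X \<in> T' <#>\<^bsub>Q\<^esub> T'" "X \<noteq> H" "z \<in> X" by blast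
    obtain x y where xy: "x \<in> T" "y \<in> T" "X = (H #> x) <#> (H #> y)"
      using X(1) unfolding mem_set_mult mult_FactGroup by blast
    have c: "x \<in> carrier G" "y \<in> carrier G" using xy Tc by auto
    have X': "X = H #> (x \<otimes> y)" using coset_mult xy c by simp
    then have "x \<otimes> y \<notin> H" using X(2) coset_eq_H_iff c by simp
    then have ne: "\<not> (x \<in> H \<and> y \<in> H)" and zH: "z \<notin> H"
      using subgroup.m_closed[OF sub] mem_r_coset_subgroup_iff[OF sub, of "x \<otimes> y" z] X(3) X' c
      by auto
    have "z \<in> H #> (x \<otimes> y)" using X(3) X' by simp
    then obtain h where h: "h \<in> H" "z = h \<otimes> (x \<otimes> y)" unfolding mem_r_coset by blast
    have hc: "h \<in> carrier G" using h Hc by auto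
    have "z \<in> T <#> T"
    proof (cases "x \<in> H")
      case False
      have "h \<otimes> x \<in> H #> x" using h unfolding mem_r_coset by blast
      then have "h \<otimes> x \<in> T" using perD[OF xy(1) False] by blast
      moreover have "z = (h \<otimes> x) \<otimes> y" using h hc c by (simp add: m_assoc)
      ultimately show ?thesis using xy unfolding mem_set_mult by blast
    next
      case True
      have "h \<otimes> y \<in> H #> y" using h unfolding mem_r_coset by blast
      then have "h \<otimes> y \<in> T" using perD[OF xy(2)] ne True by blast
      moreover have "z = x \<otimes> (h \<otimes> y)" using h hc c by (simp add: m_lcomm)
      ultimately show ?thesis using xy unfolding mem_set_mult by blast
    qed
    then show "z \<in> (T <#> T) - H" using zH by simp
  qed
  have T0: "(T \<inter> H) <#> (T \<inter> H) \<subseteq> (T <#> T) \<inter> H"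
  proof (rule Int_greatest)
    show "(T \<inter> H) <#> (T \<inter> H) \<subseteq> T <#> T" by (rule mono_set_mult) auto
    show "(T \<inter> H) <#> (T \<inter> H) \<subseteq> H" using subgroup.m_closed[OF sub] by (auto simp: set_mult_def)
  qed
  have "(T' <#>\<^bsub>Q\<^esub> T') - {H} \<subseteq> carrier Q" using TT'c by blast
  then have "card H * M = card (\<Union>((T' <#>\<^bsub>Q\<^esub> T') - {H}))"
    using card_Union_cosets M(2) by simp
  also have "\<dots> \<le> card ((T <#> T) - H)" using union finTT by (intro card_mono) auto
  finally have 1: "card H * M \<le> card ((T <#> T) - H)" .
  have 2: "card ((T \<inter> H) <#> (T \<inter> H)) \<le> card ((T <#> T) \<inter> H)" using T0 finTT by (intro card_mono) auto
  have "card (T <#> T) = card ((T <#> T) - H) + card ((T <#> T) \<inter> H)"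
    using card_Int_Diff[OF finTT, of H] by simp
  then have cTT: "card H * M + card ((T \<inter> H) <#> (T \<inter> H)) \<le> card (T <#> T)" using 1 2 by linarith
  have "2 * card T' \<le> card (T' <#>\<^bsub>Q\<^esub> T') + 1"
    by (rule card_set_mult_asym[OF _ asym_quotient]) (rule Q.finite_comm_group_axioms)
  then have Mm: "2 * m \<le> M" using m M by simp
  have m0: "2 * card (T \<inter> H) \<le> card ((T \<inter> H) <#> (T \<inter> H)) + 1"
    using card_set_mult_asym[OF finite_comm_group_subgroup[OF sub] asym_set_subgroup[OF asym sub]]
    by simp
  have H0: "card H > 0" using one_H Hc fin_sub card_gt_0_iff by blast
  have "2 * (card H * m) \<le> card H * M" using mult_le_mono2[OF Mm, of "card H"] by simp
  then show "card ((T \<inter> H) <#> (T \<inter> H)) + 1 \<le> 2 * card (T \<inter> H)"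
    using cTT cT small by linarith
  have "card H * M \<le> 2 * (card H * m)" using cTT cT small m0 by linarith
  then have "card H * M \<le> card H * (2 * m)" by simp
  then have "M \<le> 2 * m" using H0 by simp
  then show "card (T' <#>\<^bsub>Q\<^esub> T') + 1 \<le> 2 * card T'" using m M by simp
qed

text \<open>The group need not split over \<open>H\<close>, so the second coordinate is measured
  from an arbitrary representative \<open>r\<close> of the coset. This suffices because arcs between
  different cosets depend only on the cosets.\<close>

lemma pair_iso_lex:
  "\<exists>f. pair_iso f (cayley_digraph G (T - {\<one>}))
     (lex_product (cayley_digraph Q (T' - {\<one>\<^bsub>Q\<^esub>}))
       (cayley_digraph (G\<lparr>carrier := H\<rparr>) ((T \<inter> H) - {\<one>})))"
proof -
  let ?C = "cayley_digraph G (T - {\<one>})" and ?D = "cayley_digraph Q (T' - {\<one>\<^bsub>Q\<^esub>})"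
    and ?E = "cayley_digraph (G\<lparr>carrier := H\<rparr>) ((T \<inter> H) - {\<one>})"
  define r where "r X = (SOME x. x \<in> X)" for X :: "'a set"
  have r: "r (H #> x) \<in> H #> x" if "x \<in> carrier G" for x
    unfolding r_def using rcos_self[OF that sub] by (rule someI)
  have rc: "r (H #> x) \<in> carrier G" if "x \<in> carrier G" for x
    using r[OF that] r_coset_carrier_subset[OF that Hc] by blast
  define f where "f x = (H #> x, x \<otimes> inv (r (H #> x)))" for x
  have fH: "x \<otimes> inv (r (H #> x)) \<in> H" if x: "x \<in> carrier G" for x
  proof -
    obtain h where h: "h \<in> H" "r (H #> x) = h \<otimes> x" using r[OF x] unfolding mem_r_coset by blast
    have hc: "h \<in> carrier G" using h Hc by auto
    have "x \<otimes> inv (h \<otimes> x) = inv h" using x hc by (simp add: inv_mult_group flip: m_assoc)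
    then show ?thesis using h subgroup.m_inv_closed[OF sub h(1)] by simp
  qed
  have "bij_betw f (carrier G) (carrier Q \<times> H)"
  proof (rule bij_betw_imageI)
    show "inj_on f (carrier G)"
    proof (rule inj_onI)
      fix x y assume xy: "x \<in> carrier G" "y \<in> carrier G" "f x = f y"
      have "H #> x = H #> y" using arg_cong[OF xy(3), of fst] by (simp add: f_def)
      moreover have "x \<otimes> inv (r (H #> x)) = y \<otimes> inv (r (H #> y))"
        using arg_cong[OF xy(3), of snd] by (simp add: f_def)
      ultimately have "x \<otimes> inv (r (H #> y)) = y \<otimes> inv (r (H #> y))" by simp
      then show "x = y" using xy rc by simp
    qed
    show "f ` carrier G = carrier Q \<times> H"
    proof (intro equalityI subsetI)
      fix p assume "p \<in> f ` carrier G"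
      then show "p \<in> carrier Q \<times> H" using fH by (auto simp: f_def carrier_Q)
    next
      fix p assume "p \<in> carrier Q \<times> H"
      then obtain y h where p: "y \<in> carrier G" "h \<in> H" "p = (H #> y, h)" by (auto simp: carrier_Q)
      let ?x = "h \<otimes> r (H #> y)"
      have hc: "h \<in> carrier G" using p Hc by auto
      have x: "?x \<in> carrier G" using hc rc p by simp
      have "r (H #> y) \<in> carrier G" using rc p by simp
      moreover have "H #> r (H #> y) = H #> y" using coset_eq_iff rc r p by simp
      moreover have "H #> ?x = H #> r (H #> y)"
        using x rc p unfolding coset_eq_iff[OF x rc[OF p(1)]] mem_r_coset by blast
      ultimately have "f ?x = p" using p hc by (simp add: f_def m_assoc)
      then show "p \<in> f ` carrier G" using x by force
    qed
  qed
  moreover have "(f x, f y) \<in> parcs (lex_product ?D ?E) \<longleftrightarrow> (x, y) \<in> parcs ?C"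
    if x: "x \<in> carrier G" and y: "y \<in> carrier G" for x y
  proof -
    let ?z = "y \<otimes> inv x"
    have z: "?z \<in> carrier G" using x y by simp
    have X: "H #> x \<in> carrier Q" "H #> y \<in> carrier Q" using x y by (auto simp: carrier_Q)
    have "group_hom G Q (\<lambda>a. H #> a)"
      by (intro group_hom.intro group_hom_axioms.intro is_group Q.is_group normal.r_coset_hom_Mod normal)
    then have "inv\<^bsub>Q\<^esub> (H #> x) = H #> inv x" using group_hom.hom_inv x by force
    then have quot: "(H #> y) \<otimes>\<^bsub>Q\<^esub> inv\<^bsub>Q\<^esub> (H #> x) = H #> ?z" using coset_mult x y by simp
    have "(H #> x, H #> y) \<in> parcs ?D \<longleftrightarrow> H #> ?z \<in> T' - {H}"
      using Q.cayley_arc_iff[OF X, of "T' - {\<one>\<^bsub>Q\<^esub>}"] asym_quotient quot by (auto simp: asym_set_def)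
    also have "\<dots> \<longleftrightarrow> ?z \<in> T \<and> ?z \<notin> H"
      using coset_in_T'_iff[OF z] coset_eq_H_iff[OF z] by blast
    finally have D: "(H #> x, H #> y) \<in> parcs ?D \<longleftrightarrow> ?z \<in> T \<and> ?z \<notin> H" .
    have eq: "H #> x = H #> y \<longleftrightarrow> ?z \<in> H"
    proof -
      have "H #> x = H #> y \<longleftrightarrow> (\<exists>h\<in>H. y = h \<otimes> x)"
        using coset_eq_iff[OF y x] unfolding mem_r_coset by metis
      also have "\<dots> \<longleftrightarrow> ?z \<in> H"
        using inv_solve_right[OF _ y x] Hc x y by (metis subsetD)
      finally show ?thesis .
    qed
    \<comment> \<open>Inside one coset both vertices use the same representative, which cancels in
      \<open>y \<otimes> inv x\<close>.\<close>
    have E: "(x \<otimes> inv (r (H #> x)), y \<otimes> inv (r (H #> y))) \<in> parcs ?E \<longleftrightarrow> ?z \<in> T \<and> ?z \<in> H \<and> ?z \<noteq> \<one>"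
      if e: "H #> x = H #> y"
    proof -
      let ?c = "inv (r (H #> y))"
      have c: "?c \<in> carrier G" using rc y by simp
      have S: "(T \<inter> H) - {\<one>} \<subseteq> carrier G" using Tc by auto
      have "(x \<otimes> ?c, y \<otimes> ?c) \<in> parcs ?E \<longleftrightarrow> (x \<otimes> ?c, y \<otimes> ?c) \<in> parcs (cayley_digraph G ((T \<inter> H) - {\<one>}))"
        using fH[OF x] e Hc unfolding cayley_arc by auto
      also have "\<dots> \<longleftrightarrow> y \<otimes> ?c \<otimes> inv (x \<otimes> ?c) \<in> (T \<inter> H) - {\<one>}"
        using x y c S by (intro cayley_arc_iff) auto
      also have "y \<otimes> ?c \<otimes> inv (x \<otimes> ?c) = ?z"
      proof -
        have "?c \<otimes> (inv ?c \<otimes> inv x) = inv x"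
          using x c by (simp del: inv_inv flip: m_assoc)
        then show ?thesis using x y c by (simp add: inv_mult_group m_assoc del: inv_inv)
      qed
      finally show ?thesis using e by auto
    qed
    have C: "(x, y) \<in> parcs ?C \<longleftrightarrow> ?z \<in> T \<and> ?z \<noteq> \<one>"
    proof -
      have "T - {\<one>} \<subseteq> carrier G" using Tc by blast
      from cayley_arc_iff[OF x y this] show ?thesis by simp
    qed
    have "(f x, f y) \<in> parcs (lex_product ?D ?E) \<longleftrightarrow>
        (H #> x, H #> y) \<in> parcs ?D \<or> H #> x = H #> y \<and>
          (x \<otimes> inv (r (H #> x)), y \<otimes> inv (r (H #> y))) \<in> parcs ?E"
      using X fH[OF x] fH[OF y] by (auto simp: lex_product_def f_def)
    also have "\<dots> \<longleftrightarrow> ?z \<in> T \<and> ?z \<noteq> \<one>"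
      using D E eq one_H by metis
    finally show ?thesis using C by simp
  qed
  moreover have "T - {\<one>} \<subseteq> carrier G - {\<one>}" using Tc by auto
  ultimately have "pair_iso f ?C (lex_product ?D ?E)"
    by (simp add: pair_iso_def pair_wf_cayley pair_wf_lex_product) (simp add: lex_product_def)
  then show ?thesis by blast
qed

text \<open>The preimage of \<open>L\<close> in \<open>G\<close> is periodic, so by maximality it is no larger than \<open>H\<close>.\<close>

lemma quotient_primitive:
  assumes max: "\<And>K. periodic_outside K T \<Longrightarrow> card K \<le> card H"
    and L: "Q.periodic_outside L T'"
  shows "L = {\<one>\<^bsub>Q\<^esub>}"
proof -
  let ?K = "{x \<in> carrier G. H #> x \<in> L}"
  have subL: "subgroup L Q" and Lne: "L \<noteq> carrier Q"
    and Lper: "\<And>X. X \<in> T' \<Longrightarrow> X \<notin> L \<Longrightarrow> L #>\<^bsub>Q\<^esub> X \<subseteq> T'"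
    using L by (auto simp: Q.periodic_outside_def)
  have Lc: "L \<subseteq> carrier Q" using subgroup.subset[OF subL] .
  have HL: "H \<in> L" using subgroup.one_closed[OF subL] by simp
  have hom: "group_hom G Q (\<lambda>a. H #> a)"
    by (intro group_hom.intro group_hom_axioms.intro is_group Q.is_group normal.r_coset_hom_Mod normal)
  have subK: "subgroup ?K G"
  proof (rule subgroupI)
    show "?K \<noteq> {}" using HL coset_eq_H_iff[of \<one>] one_H by force
    fix a assume a: "a \<in> ?K"
    have "H #> inv a = inv\<^bsub>Q\<^esub> (H #> a)" using group_hom.hom_inv[OF hom] a by force
    then show "inv a \<in> ?K" using a subgroup.m_inv_closed[OF subL] by simp
    fix b assume b: "b \<in> ?K"
    have "(H #> a) \<otimes>\<^bsub>Q\<^esub> (H #> b) \<in> L" using a b subgroup.m_closed[OF subL] by blast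
    then show "a \<otimes> b \<in> ?K" using a b coset_mult by simp
  qed auto
  have "?K \<noteq> carrier G"
  proof
    assume "?K = carrier G"
    then have "carrier Q \<subseteq> L" unfolding carrier_Q by blast
    then show False using Lne Lc by blast
  qed
  moreover have "?K #> x \<subseteq> T" if x: "x \<in> T - ?K" for x
  proof
    fix y assume "y \<in> ?K #> x"
    then obtain a where a: "a \<in> carrier G" "H #> a \<in> L" "y = a \<otimes> x" unfolding mem_r_coset by blast
    have xc: "x \<in> carrier G" "H #> x \<notin> L" using x Tc by auto
    have yc: "y \<in> carrier G" using a xc by simp
    have Hy: "H #> y = (H #> a) \<otimes>\<^bsub>Q\<^esub> (H #> x)" using coset_mult a xc by simp
    then have "H #> y \<in> L #>\<^bsub>Q\<^esub> (H #> x)" using a unfolding mem_r_coset by blast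
    moreover have "L #>\<^bsub>Q\<^esub> (H #> x) \<subseteq> T'" using Lper x xc by blast
    ultimately have yT': "H #> y \<in> T'" by blast
    \<comment> \<open>Membership in \<open>T'\<close> can be pulled back to \<open>T\<close> only
      off \<open>H\<close>. If \<open>y\<close> were in \<open>H\<close>, then \<open>y\<close>, and
      with it \<open>x\<close>, would lie in the preimage \<open>?K\<close>.\<close>
    have "y \<notin> H"
    proof
      assume "y \<in> H"
      then have "H #> y = H" using coset_eq_H_iff yc by simp
      then have "H #> y \<in> L" using HL by simp
      then have "y \<in> ?K" "a \<in> ?K" using yc a by auto
      then have "y \<in> ?K \<longleftrightarrow> x \<in> ?K"
        using mem_r_coset_subgroup_iff[OF subK xc(1)] a(3) unfolding mem_r_coset by blast
      then show False using \<open>y \<in> ?K\<close> xc by simp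
    qed
    then show "y \<in> T" using coset_in_T'_iff yc yT' by simp
  qed
  ultimately have "card ?K \<le> card H" using max subK unfolding periodic_outside_def by blast
  moreover have "H \<subseteq> ?K" using Hc HL coset_eq_H_iff by force
  ultimately have KH: "H = ?K" using fin by (intro card_seteq) auto
  show ?thesis
  proof (intro equalityI subsetI)
    fix X assume X: "X \<in> L"
    then obtain x where "x \<in> carrier G" "X = H #> x" using Lc by (auto simp: carrier_Q)
    then have "x \<in> H" using X KH by blast
    then show "X \<in> {\<one>\<^bsub>Q\<^esub>}" using \<open>X = H #> x\<close> coset_eq_H_iff Hc by auto
  qed (use HL in simp)
qed

end

text \<open>
  Taking \<open>H\<close> maximal makes the quotient a basic building block, so that the induction only descends to
  subgroups and never changes the type of the group elements.
\<close>

lemma constructible_asym: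
  assumes "finite_comm_group G" "asym_set G T" "card (T <#>\<^bsub>G\<^esub> T) + 1 \<le> 2 * card T"
  shows "constructible (cayley_digraph G (T - {\<one>\<^bsub>G\<^esub>}))"
  using assms
proof (induction "card (carrier G)" arbitrary: G T rule: less_induct)
  case less
  interpret finite_comm_group G by fact
  note T = less.prems(2) and small = less.prems(3)
  have Tc: "T \<subseteq> carrier G" and one: "\<one>\<^bsub>G\<^esub> \<in> T" using T by (auto simp: asym_set_def)
  show ?case
  \<comment> \<open>In the trivial group there is no proper subgroup to maximise over.\<close>
  proof (cases "carrier G = {\<one>\<^bsub>G\<^esub>}")
    case True
    show ?thesis
    proof (rule constructible_primitive[OF T small])
      fix H assume "periodic_outside H T"
      then have "subgroup H G" by (simp add: periodic_outside_def)
      then show "H = {\<one>\<^bsub>G\<^esub>}" using True subgroup.subset subgroup.one_closed by fastforce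
    qed
  next
    case False
    have "{\<one>\<^bsub>G\<^esub>} #>\<^bsub>G\<^esub> x \<subseteq> T" if "x \<in> T" for x
      using that Tc by (auto simp: r_coset_def)
    then have P1: "periodic_outside {\<one>\<^bsub>G\<^esub>} T"
      using False triv_subgroup by (auto simp: periodic_outside_def)
    have bound: "\<forall>K. periodic_outside K T \<longrightarrow> card K < Suc (card (carrier G))"
      unfolding periodic_outside_def less_Suc_eq_le
      by (intro allI impI card_mono fin) (rule subgroup.subset, blast)
    \<comment> \<open>\<open>H\<close> may be trivial. The quotient then carries the whole digraph,
      and the recursive call handles a one-vertex digraph.\<close>
    obtain H where H: "periodic_outside H T"
      and max: "\<And>K. periodic_outside K T \<Longrightarrow> card K \<le> card H"
      using ex_has_greatest_nat[of "\<lambda>K. periodic_outside K T" "{\<one>\<^bsub>G\<^esub>}" card "Suc (card (carrier G))"]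
        P1 bound by auto
    interpret P: periodic_quotient G H T by unfold_locales fact+
    have "constructible (cayley_digraph (G Mod H) (P.T' - {\<one>\<^bsub>G Mod H\<^esub>}))"
      by (rule P.Q.constructible_primitive[OF P.asym_quotient P.card_set_mult_factors(1)[OF small] P.quotient_primitive[OF max]])
    moreover have "card H < card (carrier G)"
      using P.Hc P.Hne fin by (intro psubset_card_mono) auto
    then have "constructible (cayley_digraph (G\<lparr>carrier := H\<rparr>) ((T \<inter> H) - {\<one>\<^bsub>G\<^esub>}))"
      using less.hyps[of "G\<lparr>carrier := H\<rparr>" "T \<inter> H"] finite_comm_group_subgroup[OF P.sub]
        asym_set_subgroup[OF T P.sub] P.card_set_mult_factors(2)[OF small] by simp
    ultimately have "constructible (lex_product (cayley_digraph (G Mod H) (P.T' - {\<one>\<^bsub>G Mod H\<^esub>}))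
       (cayley_digraph (G\<lparr>carrier := H\<rparr>) ((T \<inter> H) - {\<one>\<^bsub>G\<^esub>})))"
      by (rule constructible_lex_product)
    then show ?thesis using P.pair_iso_lex pair_iso_inv constructible_pair_iso by blast
  qed
qed

section \<open>From Seymour orientations to asymmetric sets\<close>

theorem theorem1p3:
  fixes A :: "('a, 'b) monoid_scheme" and S :: "'a set"
  assumes "comm_group A"
    and "finite (carrier A)"
    and "S \<subseteq> carrier A - {\<one>\<^bsub>A\<^esub>}"
    and "seymour_orientation (cayley_digraph A S)"
  shows "constructible (cayley_digraph A S)"
proof -
  interpret comm_group A by fact
  interpret finite_comm_group A by unfold_locales fact
  let ?C = "cayley_digraph A S" and ?T = "insert \<one>\<^bsub>A\<^esub> S"
  have Sc: "S \<subseteq> carrier A" and S1: "\<one>\<^bsub>A\<^esub> \<notin> S" using assms(3) by auto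
  have orient: "(b, a) \<notin> parcs ?C" if "(a, b) \<in> parcs ?C" for a b
    using assms(4) that by (auto simp: seymour_orientation_def orientation_def)
  have arc1: "(\<one>\<^bsub>A\<^esub>, s) \<in> parcs ?C" if "s \<in> S" for s
    using that Sc unfolding cayley_arc by (auto intro!: bexI[of _ s])
  \<comment> \<open>A non-trivial solution of \<open>x y = \<one>\<close> would give the opposite
    arcs from \<open>\<one>\<close> to \<open>x\<close> and from \<open>x\<close> back to
    \<open>\<one>\<close>.\<close>
  have T: "asym_set A ?T"
    unfolding asym_set_def
  proof (intro conjI ballI impI)
    fix x y assume x: "x \<in> ?T" and y: "y \<in> ?T" and xy: "x \<otimes>\<^bsub>A\<^esub> y = \<one>\<^bsub>A\<^esub>"
    show "x = \<one>\<^bsub>A\<^esub>"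
    proof (rule ccontr)
      assume ne: "x \<noteq> \<one>\<^bsub>A\<^esub>"
      then have xS: "x \<in> S" using x by simp
      have "y \<noteq> \<one>\<^bsub>A\<^esub>" using xy ne xS Sc by auto
      then have "(x, \<one>\<^bsub>A\<^esub>) \<in> parcs ?C"
        using y xy xS Sc unfolding cayley_arc by (auto intro!: bexI[of _ y])
      then show False using orient arc1[OF xS] by blast
    qed
  qed (use Sc in auto)
  have N1: "N1 ?C \<one>\<^bsub>A\<^esub> = S"
    using Sc by (force simp: N1_def cayley_arc)
  \<comment> \<open>A product outside \<open>?T\<close> is reached from \<open>\<one>\<close> by two
    arcs. Hence the square has at most \<open>card ?T + card S = 2 * card ?T - 1\<close>
    elements.\<close>
  have "?T <#>\<^bsub>A\<^esub> ?T \<subseteq> ?T \<union> N2 ?C \<one>\<^bsub>A\<^esub>"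
  proof
    fix z assume "z \<in> ?T <#>\<^bsub>A\<^esub> ?T"
    then obtain x y where xy: "x \<in> ?T" "y \<in> ?T" "z = x \<otimes>\<^bsub>A\<^esub> y" unfolding mem_set_mult by blast
    show "z \<in> ?T \<union> N2 ?C \<one>\<^bsub>A\<^esub>"
    proof (cases "z \<in> ?T")
      case False
      have "x \<in> S" "y \<in> S" using False xy Sc by auto
      moreover from this have "(x, z) \<in> parcs ?C" using xy Sc unfolding cayley_arc by auto
      moreover have "z \<in> carrier A" using calculation xy Sc by auto
      ultimately show ?thesis using False unfolding N2_def N1 by auto
    next
      case True
      then show ?thesis by (rule UnI1)
    qed
  qed
  moreover have "finite (N2 ?C \<one>\<^bsub>A\<^esub>)" using fin by (simp add: N2_def)
  moreover have finS: "finite S" using Sc by (rule fin_sub)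
  ultimately have "card (?T <#>\<^bsub>A\<^esub> ?T) \<le> card (?T \<union> N2 ?C \<one>\<^bsub>A\<^esub>)"
    by (intro card_mono) auto
  also have "\<dots> \<le> card ?T + card (N2 ?C \<one>\<^bsub>A\<^esub>)" by (rule card_Un_le)
  finally have 1: "card (?T <#>\<^bsub>A\<^esub> ?T) \<le> card ?T + card (N2 ?C \<one>\<^bsub>A\<^esub>)" .
  have "\<forall>v\<in>carrier A. card (N2 ?C v) \<le> card (N1 ?C v)"
    using assms(4) by (simp add: seymour_orientation_def)
  then have "card (N2 ?C \<one>\<^bsub>A\<^esub>) \<le> card S" using N1 one_closed by metis
  then have "card (?T <#>\<^bsub>A\<^esub> ?T) + 1 \<le> 2 * card ?T" using 1 finS S1 by simp
  then have "constructible (cayley_digraph A (?T - {\<one>\<^bsub>A\<^esub>}))"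
    using constructible_asym[OF finite_comm_group_axioms T] by blast
  moreover have "?T - {\<one>\<^bsub>A\<^esub>} = S" using S1 by auto
  ultimately show ?thesis by simp
qed

end
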